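(* Let $a\ge2$ be an integer, $\alpha:=\log(a/(a-1))$, $\gamma$ the Euler--Mascheroni constant, and $N_q$ as in the context. Let $Z$ be a random variable with the Gumbel distribution. Then $$\limsup_{q\to\infty}\Bigl|\operatorname{var}N_q-\frac{\pi^2}{6\alpha^2}\Bigr|\le\theta(\alpha)+1-e^{-1}+\frac{2\bigl(\gamma+E_1(1)\bigr)}{\alpha},$$ where $\theta(\alpha)=E\bigl((1+\alpha^{-1}Z)^2\mathbf{1}_{0<1+\alpha^{-1}Z\le1}\bigr)$ satisfies $0<\theta(\alpha)<1$, and $E_1(1)=\int_1^\infty t^{-1}e^{-t}\,dt$.
   Context: Coupon collecting: fix an integer $a\ge2$. Let $Y$ be the number of independent uniform draws (with replacement) from a set of $a$ types needed until every one of the $a$ types has been drawn at least once. For $q\in\{1,2,\ldots\}$, $N_q:=\max\{Y_1,\ldots,Y_q\}$, where $Y_1,\ldots,Y_q$ are independent random variables each distributed as $Y$. (Equivalently, a test has $q$ questions, each chosen independently and uniformly from its own separate bank of $a$ alternatives; $N_q$ is the number of independently generated tests needed to see all $aq$ questions at least once.) The integer $a$ is fixed while $q\to\infty$. The Gumbel distribution has distribution function $\Lambda(x)=\exp(-e^{-x})$, $x\in\mathbb{R}$. $\mathbf{1}_T$ equals $1$ if the statement $T$ is true and $0$ otherwise; $\operatorname{var}$ denotes variance. The number $E_1(1)$ is a value of the exponential integral, numerically about $0.2194$. *)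

theory Defs
  imports "HOL-Probability.Probability"
begin

(* Draw n of the collector is omega !! n.  On the null event that some type is never
   drawn, the value of LEAST is unspecified. *)
definition coupon_time :: "nat \<Rightarrow> nat stream \<Rightarrow> nat" where
  "coupon_time a \<omega> = (LEAST n. {..<a} \<subseteq> set (stake n \<omega>))"

definition coupon_law :: "nat \<Rightarrow> nat measure" where
  "coupon_law a =
     distr (stream_space (measure_pmf (pmf_of_set {..<a}))) (count_space UNIV) (coupon_time a)"

(* distr is only meaningful for measurable maps. *)
lemma measurable_coupon_time [measurable]:
  "coupon_time a \<in> stream_space (measure_pmf p) \<rightarrow>\<^sub>M count_space UNIV"
proof -
  have eq: "coupon_time a = (\<lambda>\<omega>. LEAST n. \<forall>k\<in>{..<a}. \<exists>i\<in>{..<n}. \<omega> !! i = k)"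
    unfolding coupon_time_def
    by (intro ext arg_cong[where f = Least]) (force simp: set_conv_nth subset_eq)
  have [measurable]: "(\<lambda>\<omega>. \<omega> !! i) \<in> stream_space (measure_pmf p) \<rightarrow>\<^sub>M count_space UNIV" for i
    using measurable_snth[of i "measure_pmf p"]
    by (simp add: measurable_cong_sets[OF refl sets_measure_pmf_count_space])
  show ?thesis
    unfolding eq by measurable
qed

definition gumbel_distributed :: "'w measure \<Rightarrow> ('w \<Rightarrow> real) \<Rightarrow> bool" where
  "gumbel_distributed P Z \<longleftrightarrow>
     Z \<in> borel_measurable P \<and> (\<forall>x. cdf (distr P borel Z) x = exp (- exp (- x)))"

definition theta :: "'w measure \<Rightarrow> ('w \<Rightarrow> real) \<Rightarrow> real \<Rightarrow> real" where
  "theta P Z \<alpha> =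
     prob_space.expectation P
       (\<lambda>w. (1 + Z w / \<alpha>)\<^sup>2 * of_bool (0 < 1 + Z w / \<alpha> \<and> 1 + Z w / \<alpha> \<le> 1))"

definition exp_integral_E1 :: "real \<Rightarrow> real" where
  "exp_integral_E1 x = (LBINT t:{x..}. exp (- t) / t)"

end

theory Submission
  imports Defs "HOL-Real_Asymp.Real_Asymp"
begin

text \<open>
  Let \<open>p\<^sub>n = P(Y > n)\<close>. Since \<open>p\<^sub>n \<sim> a (1 - 1/a)\<^sup>n = a exp (-\<alpha>n)\<close>, the distribution function
  \<open>(1 - p\<^sub>n)\<^sup>q\<close> of \<open>N\<^sub>q\<close> is close to \<open>exp (-q a exp (-\<alpha>n))\<close>, which is the value at \<open>n\<close> of the distribution
  function of \<open>\<lceil>b\<^sub>q + Z/\<alpha>\<rceil>\<close>, where \<open>b\<^sub>q = ln (aq)/\<alpha>\<close>. After both variables are shifted by \<open>\<lceil>b\<^sub>q\<rceil>\<close>,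
  their point probabilities have a common two-sided geometric majorant, so dominated convergence shows
  that the difference of the variances tends to 0. With \<open>D\<close> the rounding error,
  \<open>var \<lceil>b + Z/\<alpha>\<rceil> = var Z / \<alpha>\<^sup>2 + 2 cov (Z, D) / \<alpha> + var D\<close>, where \<open>var Z = \<pi>\<^sup>2/6\<close>, \<open>var D \<le> 1/4 < 1 - 1/e\<close> and
  \<open>\<bar>cov (Z, D)\<bar> \<le> E\<bar>Z - \<gamma>\<bar> / 2 \<le> E Z\<^sup>+ = \<gamma> + E\<^sub>1(1)\<close>.
\<close>

section \<open>Moments of the Gumbel distribution\<close>

text \<open>P(exp (-Z) <= b) = P(Z >= -ln b) = 1 - exp (-b). Every Gumbel expectation thereby
  becomes an integral against exp (-t) on the positive half-line.\<close>

lemma gumbel_exp_distributed: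
  assumes "prob_space P" and Z: "gumbel_distributed P Z"
  shows "distributed P lborel (\<lambda>w. exp (- Z w)) (exponential_density 1)"
proof -
  interpret prob_space P by fact
  have [measurable]: "Z \<in> borel_measurable P"
    and cdf: "\<And>x. cdf (distr P borel Z) x = exp (- exp (- x))"
    using Z by (auto simp: gumbel_distributed_def)
  interpret D: prob_space "distr P borel Z" by (rule prob_space_distr) simp
  interpret D: finite_borel_measure "distr P borel Z"
    by unfold_locales simp
  \<comment> \<open>Continuity of the distribution function excludes atoms, so P(Z >= x) is 1 minus
    the distribution function at x.\<close>
  have null: "measure (distr P borel Z) {x} = 0" for x
  proof -
    have "cdf (distr P borel Z) = (\<lambda>x. exp (- exp (- x)))" by (simp add: cdf fun_eq_iff)
    thus ?thesis unfolding D.isCont_cdf [symmetric] by (auto intro!: continuous_intros)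
  qed
  have "prob {w \<in> space P. exp (- Z w) \<le> b} = 1 - exp (- b * 1)" if "0 \<le> b" for b
  proof (cases "b = 0")
    case False
    with that have b: "b > 0" by simp
    have "exp (- z) \<le> b \<longleftrightarrow> - ln b \<le> z" for z :: real
      using b ln_ge_iff[of b "- z"] by auto
    hence "prob {w \<in> space P. exp (- Z w) \<le> b} = measure (distr P borel Z) {- ln b ..}"
      by (subst measure_distr) (auto intro!: arg_cong[where f = prob])
    also have "{- ln b ..} = UNIV - ({.. - ln b} - {- ln b})" by auto
    also have "measure (distr P borel Z) \<dots> = 1 - (cdf (distr P borel Z) (- ln b) - 0)"
      unfolding cdf_def null [symmetric, of "- ln b"]
      using D.prob_compl[of "{.. - ln b} - {- ln b}"]
      by (subst D.finite_measure_Diff [symmetric]) auto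
    also have "\<dots> = 1 - exp (- b * 1)" using b by (simp add: cdf)
    finally show ?thesis .
  qed (auto simp: not_le)
  thus ?thesis
    by (subst exponential_distributed_iff) auto
qed

text \<open>The substitution t = exp (-Z). As an equivalence it carries both integrability and value
  in either direction, which is used both ways for the negative part of \<open>Z\<close>.\<close>

lemma gumbel_expectation_conv:
  fixes g :: "real \<Rightarrow> real"
  assumes P: "prob_space P" and Z: "gumbel_distributed P Z" and [measurable]: "g \<in> borel_measurable borel"
  shows "has_bochner_integral P (\<lambda>w. g (Z w)) x \<longleftrightarrow>
         has_bochner_integral lborel (\<lambda>t. indicator {0<..} t * (exp (- t) * g (- ln t))) x"
proof -
  note D = gumbel_exp_distributed[OF P Z]
  \<comment> \<open>The integrands can differ only at t = 0, where the density is 1 but the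
    indicator is 0.\<close>
  have ae: "AE t in lborel. exponential_density 1 t *\<^sub>R g (- ln t) =
          indicator {0<..} t * (exp (- t) * g (- ln t))"
    using AE_lborel_singleton[of 0] by eventually_elim (auto simp: exponential_density_def)
  have *: "has_bochner_integral P (\<lambda>w. g (Z w)) x \<longleftrightarrow>
        has_bochner_integral lborel (\<lambda>t. exponential_density 1 t *\<^sub>R g (- ln t)) x"
    using distributed_integrable[OF D, of "\<lambda>t. g (- ln t)"]
          distributed_integral[OF D, of "\<lambda>t. g (- ln t)"]
    by (simp add: has_bochner_integral_iff exponential_density_nonneg)
  show ?thesis
    unfolding * by (rule has_bochner_integral_cong_AE) (use ae in auto)
qed

text \<open>The substitution turns the expectation into Euler's integral of t powr (-s) * exp (-t),
  which converges for s < 1.\<close>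

lemma gumbel_mgf:
  assumes P: "prob_space P" and Z: "gumbel_distributed P Z" and s: "s < 1"
  shows "has_bochner_integral P (\<lambda>w. exp (s * Z w)) (Gamma (1 - s))"
proof -
  have "has_bochner_integral lborel (\<lambda>t. indicator {0..} t * (t powr (1 - s - 1) / exp t)) (Gamma (1 - s))"
    using Gamma_conv_nn_integral_real[of "1 - s"] s Gamma_real_pos[of "1 - s"]
    by (intro has_bochner_integral_nn_integral) (auto simp: mult_ac)
  also have "?this \<longleftrightarrow> has_bochner_integral lborel
       (\<lambda>t. indicator {0<..} t * (exp (- t) * exp (s * - ln t))) (Gamma (1 - s))"
  proof (rule has_bochner_integral_cong_AE)
    show "AE t in lborel. indicator {0..} t * (t powr (1 - s - 1) / exp t) =
          indicator {0<..} t * (exp (- t) * exp (s * - ln t))"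
      using AE_lborel_singleton[of 0]
      by eventually_elim (auto simp: powr_def exp_minus field_simps split: split_indicator)
  qed auto
  finally show ?thesis
    using gumbel_expectation_conv[OF P Z, of "\<lambda>z. exp (s * z)"] by simp
qed

section \<open>Moments read off a moment generating function\<close>

lemma exp_abs_integrable:
  fixes X :: "'a \<Rightarrow> real"
  assumes [measurable]: "X \<in> borel_measurable M"
  assumes "integrable M (\<lambda>w. exp (r * X w))" "integrable M (\<lambda>w. exp (- r * X w))"
  shows "integrable M (\<lambda>w. exp (\<bar>r\<bar> * \<bar>X w\<bar>))"
proof (rule Bochner_Integration.integrable_bound)
  show "integrable M (\<lambda>w. exp (r * X w) + exp (- r * X w))"
    using assms by auto
  show "AE w in M. norm (exp (\<bar>r\<bar> * \<bar>X w\<bar>)) \<le> norm (exp (r * X w) + exp (- r * X w))"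
  proof (rule AE_I2)
    fix w
    have "exp (\<bar>r\<bar> * \<bar>X w\<bar>) \<le> exp (r * X w) + exp (- r * X w)"
      by (auto simp: abs_if add_increasing add_increasing2)
    thus "norm (exp (\<bar>r\<bar> * \<bar>X w\<bar>)) \<le> norm (exp (r * X w) + exp (- r * X w))"
      by simp
  qed
qed simp

text \<open>The quadratic term of the exponential series. It absorbs a quadratic factor into an
  exponential of arbitrarily small rate \<open>d\<close>.\<close>

lemma square_le_exp_abs:
  fixes u d :: real
  assumes "d > 0"
  shows "u\<^sup>2 \<le> 2 / d\<^sup>2 * exp (d * \<bar>u\<bar>)"
proof -
  have "(d * \<bar>u\<bar>)\<^sup>2 / 2 \<le> exp (d * \<bar>u\<bar>)"
    using exp_lower_Taylor_quadratic[of "d * \<bar>u\<bar>"] assms mult_nonneg_nonneg[of d "\<bar>u\<bar>"]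
    by linarith
  thus ?thesis using assms by (simp add: field_simps power_mult_distrib)
qed

text \<open>The first two derivatives of the moment generating function at 0, written as symmetric
  difference quotients of \<open>F\<close>.\<close>
lemma moments_from_mgf:
  fixes X :: "'a \<Rightarrow> real" and F :: "real \<Rightarrow> real"
  assumes [measurable]: "X \<in> borel_measurable M" and r: "r > 0"
    and mgf: "\<And>s. \<bar>s\<bar> \<le> r \<Longrightarrow> has_bochner_integral M (\<lambda>w. exp (s * X w)) (F s)"
    and l1: "((\<lambda>h. (F h - F (- h)) / (2 * h)) \<longlongrightarrow> m1) (at_right 0)"
    and l2: "((\<lambda>h. (F h + F (- h) - 2 * F 0) / h\<^sup>2) \<longlongrightarrow> m2) (at_right 0)"
  shows "has_bochner_integral M X m1" and "has_bochner_integral M (\<lambda>w. (X w)\<^sup>2) m2"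
proof -
  have int: "integrable M (\<lambda>w. exp (s * X w))" "(LINT w|M. exp (s * X w)) = F s" if "\<bar>s\<bar> \<le> r" for s
    using mgf[OF that] by (auto simp: has_bochner_integral_iff)
  have E: "integrable M (\<lambda>w. exp (r * \<bar>X w\<bar>))"
    using exp_abs_integrable[of X M r] int[of r] int[of "-r"] r by simp
  \<comment> \<open>Half of the rate \<open>r\<close> bounds the exponentials in the difference
    quotients; the other half absorbs the polynomial factor of the majorant
    \<open>W\<close>.\<close>
  define d where "d = r / 2"
  have d: "d > 0" using r by (simp add: d_def)
  define W where "W = (\<lambda>u. (1 + u\<^sup>2) * exp (d * \<bar>u::real\<bar>))"
  have W: "integrable M (\<lambda>w. W (X w))"
  proof (rule Bochner_Integration.integrable_bound)
    show "integrable M (\<lambda>w. (1 + 2 / d\<^sup>2) * exp (r * \<bar>X w\<bar>))"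
      using E by simp
    have "norm (W u) \<le> norm ((1 + 2 / d\<^sup>2) * exp (r * \<bar>u\<bar>))" for u
    proof -
      have "1 + u\<^sup>2 \<le> exp (d * \<bar>u\<bar>) + 2 / d\<^sup>2 * exp (d * \<bar>u\<bar>)"
        using square_le_exp_abs[OF d, of u] d by (intro add_mono) auto
      hence "W u \<le> (1 + 2 / d\<^sup>2) * exp (d * \<bar>u\<bar>) * exp (d * \<bar>u\<bar>)"
        unfolding W_def by (intro mult_right_mono) (auto simp: algebra_simps)
      also have "\<dots> = (1 + 2 / d\<^sup>2) * exp (r * \<bar>u\<bar>)"
        by (simp add: d_def mult_exp_exp mult.assoc)
      finally show ?thesis by (simp add: W_def abs_mult)
    qed
    thus "AE w in M. norm (W (X w)) \<le> norm ((1 + 2 / d\<^sup>2) * exp (r * \<bar>X w\<bar>))" by simp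
  qed (auto simp: W_def)
  define h where "h = (\<lambda>n. d / real (Suc n))"
  have h: "h n > 0" "h n \<le> d" "h n \<le> r" "\<bar>h n\<bar> \<le> r" "\<bar>- h n\<bar> \<le> r" for n
    using d by (auto simp: h_def d_def field_simps)
  have h0: "filterlim h (at_right 0) sequentially"
    unfolding h_def using d by real_asymp
  have q1: "\<bar>(exp (t * u) - exp (- t * u)) / (2 * t)\<bar> \<le> W u" if t: "0 < t" "t \<le> d" for t u :: real
  proof -
    define x where "x = \<bar>t * u\<bar>"
    have "\<bar>exp (t * u) - exp (- t * u)\<bar> = exp x - exp (- x)"
      by (auto simp: x_def abs_if)
    \<comment> \<open>This form exposes a factor 1 - exp (-2x) <= 2x, which cancels the denominator
      2t.\<close>
    also have "\<dots> = exp x * (1 - exp (- 2 * x))"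
      by (simp add: algebra_simps mult_exp_exp)
    also have "\<dots> \<le> exp x * (2 * x)"
      using exp_ge_add_one_self[of "- 2 * x"] by (intro mult_left_mono) auto
    also have "\<dots> = 2 * t * (\<bar>u\<bar> * exp (t * \<bar>u\<bar>))"
      using t by (simp add: x_def abs_mult)
    also have "\<dots> \<le> 2 * t * W u"
      unfolding W_def
    proof (intro mult_left_mono mult_mono)
      show "\<bar>u\<bar> \<le> 1 + u\<^sup>2"
        using zero_le_power2[of "\<bar>u\<bar> - 1 / 2"] by (simp add: power2_eq_square algebra_simps)
    qed (use t in \<open>auto intro!: mult_right_mono\<close>)
    finally show ?thesis using t by (simp add: abs_divide abs_mult pos_divide_le_eq mult_ac)
  qed
  have q2: "\<bar>(exp (t * u) + exp (- t * u) - 2) / t\<^sup>2\<bar> \<le> W u" if t: "0 < t" "t \<le> d" for t u :: real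
  proof -
    define x where "x = \<bar>t * u\<bar>"
    have "exp (t * u) + exp (- t * u) - 2 = exp x + exp (- x) - 2"
      by (auto simp: x_def abs_if)
    \<comment> \<open>The second difference is exp x times a perfect square, and 1 - exp (-x) <= x
      supplies the factor needed against the squared step.\<close>
    also have "\<dots> = exp x * (1 - exp (- x))\<^sup>2"
      by (simp add: power2_eq_square algebra_simps mult_exp_exp)
    finally have eq: "exp (t * u) + exp (- t * u) - 2 = exp x * (1 - exp (- x))\<^sup>2" .
    have "\<bar>exp (t * u) + exp (- t * u) - 2\<bar> = exp x * (1 - exp (- x))\<^sup>2"
      unfolding eq by simp
    also have "\<dots> \<le> exp x * x\<^sup>2"
      using exp_ge_add_one_self[of "- x"] by (intro mult_left_mono power_mono) (auto simp: x_def)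
    also have "\<dots> = t\<^sup>2 * (u\<^sup>2 * exp (t * \<bar>u\<bar>))"
      using t by (simp add: x_def abs_mult power_mult_distrib)
    also have "\<dots> \<le> t\<^sup>2 * W u"
      unfolding W_def by (intro mult_left_mono mult_mono) (use t in \<open>auto intro!: mult_right_mono\<close>)
    finally show ?thesis using t by (simp add: abs_divide pos_divide_le_eq mult_ac)
  qed
  have t1: "((\<lambda>t. (exp (t * u) - exp (- t * u)) / (2 * t)) \<longlongrightarrow> u) (at_right 0)" for u :: real
    by (cases u "0 :: real" rule: linorder_cases) (simp_all, real_asymp+)
  have t2: "((\<lambda>t. (exp (t * u) + exp (- t * u) - 2) / t\<^sup>2) \<longlongrightarrow> u\<^sup>2) (at_right 0)" for u :: real
    unfolding power2_eq_square[of u] by (cases u "0 :: real" rule: linorder_cases) (simp_all, real_asymp+)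
  have b1: "AE w in M. norm ((exp (h n * X w) - exp (- h n * X w)) / (2 * h n)) \<le> W (X w)"
    and b2: "AE w in M. norm ((exp (h n * X w) + exp (- h n * X w) - 2) / (h n)\<^sup>2) \<le> W (X w)" for n
    unfolding real_norm_def by (intro AE_I2 q1 q2 h)+
  have c1: "AE w in M. (\<lambda>n. (exp (h n * X w) - exp (- h n * X w)) / (2 * h n)) \<longlonglongrightarrow> X w"
    and c2: "AE w in M. (\<lambda>n. (exp (h n * X w) + exp (- h n * X w) - 2) / (h n)\<^sup>2) \<longlonglongrightarrow> (X w)\<^sup>2"
    by (intro AE_I2 filterlim_compose[OF t1 h0] filterlim_compose[OF t2 h0])+
  have i1: "integrable M X"
    by (rule integrable_dominated_convergence[OF _ _ W c1 b1]) auto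
  have "(\<lambda>n. LINT w|M. (exp (h n * X w) - exp (- h n * X w)) / (2 * h n)) \<longlonglongrightarrow> (LINT w|M. X w)"
    by (rule integral_dominated_convergence[OF _ _ W c1 b1]) auto
  also have "(\<lambda>n. LINT w|M. (exp (h n * X w) - exp (- h n * X w)) / (2 * h n)) =
             (\<lambda>n. (F (h n) - F (- h n)) / (2 * h n))"
    using int[OF h(4)] int[OF h(5)] by (simp add: fun_eq_iff)
  finally have "(LINT w|M. X w) = m1"
    using filterlim_compose[OF l1 h0] LIMSEQ_unique by blast
  with i1 show "has_bochner_integral M X m1" by (simp add: has_bochner_integral_iff)
  \<comment> \<open>The total mass of \<open>M\<close> is the generating function at 0.\<close>
  have cst: "integrable M (\<lambda>_. 2::real)" "(LINT w|M. (2::real)) = 2 * F 0"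
    using int[of 0] r integrable_mult_right[of "2::real" M "\<lambda>_. 1::real"] by auto
  have i2: "integrable M (\<lambda>w. (X w)\<^sup>2)"
    by (rule integrable_dominated_convergence[OF _ _ W c2 b2]) auto
  have "(\<lambda>n. LINT w|M. (exp (h n * X w) + exp (- h n * X w) - 2) / (h n)\<^sup>2) \<longlonglongrightarrow> (LINT w|M. (X w)\<^sup>2)"
    by (rule integral_dominated_convergence[OF _ _ W c2 b2]) auto
  also have "(\<lambda>n. LINT w|M. (exp (h n * X w) + exp (- h n * X w) - 2) / (h n)\<^sup>2) =
             (\<lambda>n. (F (h n) + F (- h n) - 2 * F 0) / (h n)\<^sup>2)"
    using int[OF h(4)] int[OF h(5)] cst by (simp add: fun_eq_iff)
  finally have "(LINT w|M. (X w)\<^sup>2) = m2"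
    using filterlim_compose[OF l2 h0] LIMSEQ_unique by blast
  with i2 show "has_bochner_integral M (\<lambda>w. (X w)\<^sup>2) m2" by (simp add: has_bochner_integral_iff)
qed

text \<open>This is the second derivative of Gamma at 1: it equals Digamma(1)^2 + Polygamma 1 (1),
  where Digamma(1) = -\<gamma> and Polygamma 1 (1) is the sum of the inverse squares.\<close>

lemma deriv2_Gamma_1:
  "((\<lambda>x. Gamma x * Digamma x) has_real_derivative euler_mascheroni\<^sup>2 + pi\<^sup>2 / 6) (at 1)"
proof -
  have "(\<lambda>k. inverse ((1 + of_nat k) ^ Suc 1)) sums ((-1) ^ Suc 1 * Polygamma 1 (1::real) / fact 1)"
    by (rule Polygamma_LIMSEQ) auto
  moreover have "(\<lambda>k. inverse ((1 + of_nat k) ^ Suc 1)) sums (pi\<^sup>2 / 6)"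
    using inverse_squares_sums by (simp add: field_simps power2_eq_square)
  ultimately have "Polygamma 1 (1::real) = pi\<^sup>2 / 6"
    by (simp add: sums_iff)
  thus ?thesis
    by (auto intro!: derivative_eq_intros simp: power2_eq_square)
qed

text \<open>The moment generating function is Gamma (1 - s), so the first two moments are minus the
  first derivative and the second derivative of Gamma at 1.\<close>

lemma gumbel_moments:
  assumes P: "prob_space P" and Z: "gumbel_distributed P Z"
  shows "has_bochner_integral P Z euler_mascheroni"
    and "has_bochner_integral P (\<lambda>w. (Z w)\<^sup>2) (euler_mascheroni\<^sup>2 + pi\<^sup>2 / 6)"
proof -
  have [measurable]: "Z \<in> borel_measurable P" using Z by (simp add: gumbel_distributed_def)
  define G' where "G' = (\<lambda>x::real. Gamma x * Digamma x)"
  have G: "(Gamma has_real_derivative G' x) (at x)" if "x > 0" for x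
    unfolding G'_def using that by (intro has_field_derivative_Gamma) (auto elim!: nonpos_Ints_cases)
  have G1: "G' 1 = - euler_mascheroni" by (simp add: G'_def)
  have G': "(G' has_real_derivative euler_mascheroni\<^sup>2 + pi\<^sup>2 / 6) (at 1)"
    unfolding G'_def by (rule deriv2_Gamma_1)
  \<comment> \<open>The symmetric quotient is the average of the two one-sided ones; the sign is
    reversed because the argument 1 - h comes first.\<close>
  have sym: "((\<lambda>h. (f (1 - h) - f (1 - - h)) / (2 * h)) \<longlongrightarrow> - D) (at_right 0)"
    if "(f has_real_derivative D) (at 1)" for f :: "real \<Rightarrow> real" and D
  proof -
    have "((\<lambda>h. (f (1 + h) - f 1) / h) \<longlongrightarrow> D) (at 0)"
      using that by (simp add: DERIV_def)
    hence R: "((\<lambda>h. (f (1 + h) - f 1) / h) \<longlongrightarrow> D) (at_right 0)"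
      and L: "((\<lambda>h. (f (1 + h) - f 1) / h) \<longlongrightarrow> D) (at_left 0)"
      by (auto simp: filterlim_at_split)
    from L have "((\<lambda>h. (f (1 - h) - f 1) / (- h)) \<longlongrightarrow> D) (at_right 0)"
      by (simp add: filterlim_at_left_to_right)
    from tendsto_add[OF tendsto_mult[OF this tendsto_const[of "- 1 / 2"]]
        tendsto_mult[OF R tendsto_const[of "- 1 / 2"]]]
    show ?thesis by (simp add: diff_divide_distrib add_divide_distrib algebra_simps)
  qed
  have l1: "((\<lambda>h. (Gamma (1 - h) - Gamma (1 - - h)) / (2 * h)) \<longlongrightarrow> euler_mascheroni) (at_right (0::real))"
    using sym[OF G[of 1]] by (simp add: G1)
  \<comment> \<open>One application of l'Hopital's rule reduces the second difference quotient of
    Gamma to the symmetric first quotient of its derivative \<open>G'\<close>.\<close>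
  have l2: "((\<lambda>h. (Gamma (1 - h) + Gamma (1 - - h) - 2 * Gamma (1 - 0)) / h\<^sup>2)
             \<longlongrightarrow> euler_mascheroni\<^sup>2 + pi\<^sup>2 / 6) (at_right (0::real))"
  proof (rule lhopital_right)
    have ev: "eventually (\<lambda>h::real. 0 < h \<and> h < 1) (at_right 0)"
      by (auto simp: eventually_at_right[of _ 1] intro: exI[of _ 1])
    have c: "isCont Gamma (1::real)" using G[of 1] by (auto intro: DERIV_isCont)
    show "((\<lambda>h. Gamma (1 - h) + Gamma (1 - - h) - 2 * Gamma (1 - 0)) \<longlongrightarrow> 0) (at_right (0::real))"
      by (rule tendsto_eq_rhs, (rule tendsto_intros isCont_tendsto_compose[OF c] tendsto_eq_intros | simp)+)
    show "((\<lambda>h. h\<^sup>2) \<longlongrightarrow> 0) (at_right (0::real))"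
      by (auto intro!: tendsto_eq_intros)
    show "eventually (\<lambda>h. h\<^sup>2 \<noteq> 0) (at_right (0::real))"
      using ev by eventually_elim auto
    show "eventually (\<lambda>h. 2 * h \<noteq> 0) (at_right (0::real))"
      using ev by eventually_elim auto
    show "eventually (\<lambda>h. ((\<lambda>h. Gamma (1 - h) + Gamma (1 - - h) - 2 * Gamma (1 - 0))
        has_real_derivative - G' (1 - h) + G' (1 - - h)) (at h)) (at_right (0::real))"
      using ev
    proof eventually_elim
      case (elim h)
      have "((\<lambda>h. Gamma (1 - h)) has_real_derivative G' (1 - h) * (0 - 1)) (at h)"
        by (rule DERIV_chain2[OF G]) (use elim in \<open>auto intro!: derivative_eq_intros\<close>)
      moreover have "((\<lambda>h. Gamma (1 - - h)) has_real_derivative G' (1 - - h) * (0 - - 1)) (at h)"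
        by (rule DERIV_chain2[OF G]) (use elim in \<open>auto intro!: derivative_eq_intros\<close>)
      ultimately show ?case
        by (rule DERIV_cong[OF DERIV_diff[OF DERIV_add DERIV_const]]) simp
    qed
    show "eventually (\<lambda>h. ((\<lambda>h. h\<^sup>2) has_real_derivative 2 * h) (at h)) (at_right (0::real))"
      by (auto intro!: always_eventually derivative_eq_intros)
    have "((\<lambda>h. - ((G' (1 - h) - G' (1 - - h)) / (2 * h))) \<longlongrightarrow> - (- (euler_mascheroni\<^sup>2 + pi\<^sup>2 / 6))) (at_right 0)"
      by (intro tendsto_minus sym G')
    thus "((\<lambda>h. (- G' (1 - h) + G' (1 - - h)) / (2 * h)) \<longlongrightarrow> euler_mascheroni\<^sup>2 + pi\<^sup>2 / 6) (at_right 0)"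
      by (simp add: diff_divide_distrib add.commute)
  qed
  have mgf: "has_bochner_integral P (\<lambda>w. exp (s * Z w)) (Gamma (1 - s))" if "\<bar>s\<bar> \<le> 1 / 2" for s
    using that by (intro gumbel_mgf P Z) auto
  show "has_bochner_integral P Z euler_mascheroni"
    and "has_bochner_integral P (\<lambda>w. (Z w)\<^sup>2) (euler_mascheroni\<^sup>2 + pi\<^sup>2 / 6)"
    using moments_from_mgf[OF _ _ mgf l1 l2, where r = "1 / 2"] by auto
qed

text \<open>With t = exp (-Z) the expectation is the integral of exp (-t) * ln t over t > 1.
  Integration by parts gives that of exp (-t) / t, since exp (-t) * ln t vanishes at 1 and at
  infinity.\<close>

lemma gumbel_negative_part:
  assumes P: "prob_space P" and Z: "gumbel_distributed P Z"
  shows "has_bochner_integral P (\<lambda>w. max 0 (- Z w)) (exp_integral_E1 1)"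
proof -
  \<comment> \<open>Integrability is inherited from \<open>Z\<close>: under the substitution this
    integrand is the negative part of \<open>Z\<close>.\<close>
  have int: "set_integrable lborel {1<..} (\<lambda>t::real. exp (- t) * ln t)"
  proof -
    have "integrable P (\<lambda>w. max 0 (- Z w))"
      using gumbel_moments(1)[OF P Z] by (auto simp: has_bochner_integral_iff)
    then obtain x where "has_bochner_integral P (\<lambda>w. max 0 (- Z w)) x"
      by (auto simp: has_bochner_integral_iff)
    hence "has_bochner_integral lborel (\<lambda>t. indicator {0<..} t * (exp (- t) * max 0 (- (- ln t)))) x"
      using gumbel_expectation_conv[OF P Z, of "\<lambda>z. max 0 (- z)" x] by simp
    hence "integrable lborel (\<lambda>t::real. indicator {0<..} t * (exp (- t) * max 0 (- (- ln t))))"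
      by (simp add: has_bochner_integral_iff)
    also have "(\<lambda>t. indicator {0<..} t * (exp (- t) * max 0 (- (- ln t)))) =
               (\<lambda>t::real. indicat_real {1<..} t *\<^sub>R (exp (- t) * ln t))"
      by (auto simp: fun_eq_iff max_def not_le split: split_indicator)
    finally show ?thesis unfolding set_integrable_def .
  qed
  have int2: "set_integrable lborel {1<..} (\<lambda>t::real. exp (- t) / t)"
  proof -
    interpret prob_space P by fact
    have "has_bochner_integral P (\<lambda>_. 1 :: real) 1"
      by (simp add: has_bochner_integral_iff prob_space)
    hence "integrable lborel (\<lambda>t::real. indicat_real {0<..} t * exp (- t))"
      using gumbel_expectation_conv[OF P Z, of "\<lambda>_. 1" 1] by (simp add: has_bochner_integral_iff)
    thus ?thesis unfolding set_integrable_def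
      by (rule Bochner_Integration.integrable_bound)
         (auto simp: divide_le_eq split: split_indicator)
  qed
  have "(LBINT t=ereal 1..\<infinity>. exp (- t) / t - exp (- t) * ln t) = 0 - 0"
  proof (rule interval_integral_FTC_integrable)
    show "((\<lambda>t. exp (- t) * ln t) has_vector_derivative exp (- t) / t - exp (- t) * ln t) (at t)"
      if "ereal 1 < ereal t" for t
      using that by (auto intro!: derivative_eq_intros simp flip: has_real_derivative_iff_has_vector_derivative)
    show "isCont (\<lambda>t. exp (- t) / t - exp (- t) * ln t) t" if "ereal 1 < ereal t" for t
      using that by (auto intro!: continuous_intros)
    show "set_integrable lborel (einterval (ereal 1) \<infinity>) (\<lambda>t. exp (- t) / t - exp (- t) * ln t)"
      using set_integral_diff(1)[OF int2 int] by (simp add: einterval_def greaterThan_def)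
    have "((\<lambda>t::real. exp (- t) * ln t) \<longlongrightarrow> 0) (at_right 1)"
      by (auto intro!: tendsto_eq_intros)
    thus "(((\<lambda>t. exp (- t) * ln t) \<circ> real_of_ereal) \<longlongrightarrow> 0) (at_right (ereal 1))"
      by (simp add: ereal_tendsto_simps)
    have "((\<lambda>t::real. exp (- t) * ln t) \<longlongrightarrow> 0) at_top" by real_asymp
    thus "(((\<lambda>t. exp (- t) * ln t) \<circ> real_of_ereal) \<longlongrightarrow> 0) (at_left \<infinity>)"
      by (simp add: ereal_tendsto_simps)
  qed auto
  hence "(LBINT t:{1::real<..}. exp (- t) / t - exp (- t) * ln t) = 0"
    by (simp add: interval_integral_to_infinity_eq)
  hence "(LBINT t:{1::real<..}. exp (- t) * ln t) = (LBINT t:{1::real<..}. exp (- t) / t)"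
    using set_integral_diff(2)[OF int2 int] by simp
  \<comment> \<open>The exponential integral is taken over the closed half-line, which adds only the
    null set {1}.\<close>
  also have "\<dots> = exp_integral_E1 1"
    unfolding exp_integral_E1_def set_lebesgue_integral_def
    by (rule integral_cong_AE, simp, simp)
       (use AE_lborel_singleton[of "1::real"] in \<open>eventually_elim, auto split: split_indicator\<close>)
  finally have *: "has_bochner_integral lborel (\<lambda>t. indicator {1<..} t *\<^sub>R (exp (- t) * ln t)) (exp_integral_E1 1)"
    using int by (simp add: has_bochner_integral_iff set_integrable_def set_lebesgue_integral_def)
  also have "(\<lambda>t::real. indicator {1<..} t *\<^sub>R (exp (- t) * ln t)) =
             (\<lambda>t::real. indicator {0<..} t * (exp (- t) * max 0 (- (- ln t))))"
    by (auto simp: fun_eq_iff max_def not_le split: split_indicator)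
  finally show ?thesis
    using gumbel_expectation_conv[OF P Z, of "\<lambda>z. max 0 (- z)"] by simp
qed

section \<open>Rounding an affine image of a Gumbel variable\<close>

lemma gumbel_cdf:
  assumes "gumbel_distributed P Z"
  shows "measure P {w \<in> space P. Z w \<le> x} = exp (- exp (- x))"
proof -
  have [measurable]: "Z \<in> borel_measurable P" using assms by (simp add: gumbel_distributed_def)
  have "measure P {w \<in> space P. Z w \<le> x} = cdf (distr P borel Z) x"
    unfolding cdf_def by (subst measure_distr) (auto intro!: arg_cong[where f = "measure P"])
  thus ?thesis using assms by (simp add: gumbel_distributed_def)
qed

text \<open>Pointwise |z - \<gamma>| <= 2 max(z, 0) - (z - \<gamma>) because \<gamma> > 0. The last
  term has mean 0, and the positive part, z + max(-z, 0), has mean \<gamma> + E1(1).\<close>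

lemma gumbel_abs_deviation:
  assumes P: "prob_space P" and Z: "gumbel_distributed P Z"
  shows "(LINT w|P. \<bar>Z w - euler_mascheroni\<bar>) \<le> 2 * (euler_mascheroni + exp_integral_E1 1)"
proof -
  interpret prob_space P by fact
  note m = gumbel_moments(1)[OF P Z] gumbel_negative_part[OF P Z]
  have "has_bochner_integral P
          (\<lambda>w. 2 * (Z w + max 0 (- Z w)) - (Z w - euler_mascheroni))
          (2 * (euler_mascheroni + exp_integral_E1 1) - (euler_mascheroni - euler_mascheroni))"
    using m by (auto simp: has_bochner_integral_iff prob_space)
  moreover have "(LINT w|P. \<bar>Z w - euler_mascheroni\<bar>) \<le>
                 (LINT w|P. 2 * (Z w + max 0 (- Z w)) - (Z w - euler_mascheroni))"
    using m euler_mascheroni_pos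
    by (intro integral_mono) (auto simp: has_bochner_integral_iff)
  ultimately show ?thesis by (simp add: has_bochner_integral_iff)
qed

text \<open>Rounding \<open>Z / \<alpha>\<close> adds an error \<open>D \<in> [0, 1)\<close>, which contributes \<open>var D \<le> 1/4\<close> and a covariance of
  size at most \<open>E\<bar>Z - \<gamma>\<bar> / (2\<alpha>)\<close>.\<close>
lemma gumbel_ceiling_variance:
  fixes b :: real and m :: int
  assumes P: "prob_space P" and Z: "gumbel_distributed P Z" and \<alpha>: "\<alpha> > 0"
  shows "\<bar>prob_space.variance P (\<lambda>w. real_of_int (\<lceil>b + Z w / \<alpha>\<rceil> - m)) - pi\<^sup>2 / (6 * \<alpha>\<^sup>2)\<bar>
           \<le> 1 / 4 + 2 * (euler_mascheroni + exp_integral_E1 1) / \<alpha>"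
proof -
  interpret prob_space P by fact
  have [measurable]: "Z \<in> borel_measurable P" using Z by (simp add: gumbel_distributed_def)
  define z where "z = (\<lambda>w. Z w - euler_mascheroni)"
  \<comment> \<open>Subtracting 1/2 places the rounding error in [-1/2, 1/2). This changes neither
    its variance nor its covariance with \<open>z\<close>, and the bound 1/2 yields the constants
    1/4 and 1/2.\<close>
  define e where "e = (\<lambda>w. real_of_int \<lceil>b + Z w / \<alpha>\<rceil> - (b + Z w / \<alpha>) - 1 / 2)"
  define c where "c = b + euler_mascheroni / \<alpha> + 1 / 2 - of_int m"
  define \<delta> where "\<delta> = expectation e"
  have [measurable]: "z \<in> borel_measurable P" "e \<in> borel_measurable P"
    unfolding z_def e_def by measurable
  have e: "\<bar>e w\<bar> \<le> 1 / 2" for w unfolding e_def by linarith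
  have e2: "(e w)\<^sup>2 \<le> (1 / 2)\<^sup>2" for w
    using power_mono[OF e[of w], of 2] by simp
  have X: "real_of_int (\<lceil>b + Z w / \<alpha>\<rceil> - m) = c + z w / \<alpha> + e w" for w
    using \<alpha> by (simp add: c_def z_def e_def diff_divide_distrib)
  note mom = gumbel_moments[OF P Z]
  have z: "integrable P z" "expectation z = 0"
    using mom by (auto simp: z_def has_bochner_integral_iff prob_space)
  have z2: "has_bochner_integral P (\<lambda>w. (z w)\<^sup>2) (pi\<^sup>2 / 6)"
  proof -
    have "has_bochner_integral P (\<lambda>w. (Z w)\<^sup>2 - 2 * euler_mascheroni * Z w + euler_mascheroni\<^sup>2)
      (euler_mascheroni\<^sup>2 + pi\<^sup>2 / 6 - 2 * euler_mascheroni * euler_mascheroni + euler_mascheroni\<^sup>2)"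
      using mom by (auto simp: has_bochner_integral_iff prob_space)
    thus ?thesis by (simp add: z_def power2_eq_square algebra_simps)
  qed
  hence z2i: "integrable P (\<lambda>w. (z w)\<^sup>2)" and z2e: "expectation (\<lambda>w. (z w)\<^sup>2) = pi\<^sup>2 / 6"
    by (auto simp only: has_bochner_integral_iff)
  have ie: "integrable P e" "integrable P (\<lambda>w. (e w)\<^sup>2)"
  proof -
    show "integrable P e"
      using e by (intro integrable_const_bound[of _ "1 / 2"]) auto
    show "integrable P (\<lambda>w. (e w)\<^sup>2)"
      using e e2 by (intro integrable_const_bound[of _ "(1 / 2)\<^sup>2"]) auto
  qed
  have ze_bound: "norm (z w * e w) \<le> 1 / 2 * \<bar>z w\<bar>" for w
    using mult_left_mono[OF e[of w], of "\<bar>z w\<bar>"] by (simp add: abs_mult)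
  have ize: "integrable P (\<lambda>w. z w * e w)"
    by (rule Bochner_Integration.integrable_bound[of _ "\<lambda>w. 1 / 2 * \<bar>z w\<bar>"])
       (use ze_bound z in auto)
  have cov: "\<bar>expectation (\<lambda>w. z w * e w)\<bar> \<le> euler_mascheroni + exp_integral_E1 1"
  proof -
    have "\<bar>expectation (\<lambda>w. z w * e w)\<bar> \<le> expectation (\<lambda>w. \<bar>z w * e w\<bar>)"
      using integral_norm_bound[of P "\<lambda>w. z w * e w"] by simp
    also have "\<dots> \<le> expectation (\<lambda>w. 1 / 2 * \<bar>z w\<bar>)"
      using ize z ze_bound by (intro integral_mono) auto
    also have "\<dots> \<le> euler_mascheroni + exp_integral_E1 1"
      using gumbel_abs_deviation[OF P Z] by (simp add: z_def)
    finally show ?thesis .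
  qed
  have var_e: "0 \<le> expectation (\<lambda>w. (e w)\<^sup>2) - \<delta>\<^sup>2" "expectation (\<lambda>w. (e w)\<^sup>2) - \<delta>\<^sup>2 \<le> 1 / 4"
  proof -
    show "0 \<le> expectation (\<lambda>w. (e w)\<^sup>2) - \<delta>\<^sup>2"
      using variance_eq[OF ie] variance_positive[of e] by (simp add: \<delta>_def)
    have "expectation (\<lambda>w. (e w)\<^sup>2) \<le> expectation (\<lambda>w. (1 / 2)\<^sup>2)"
      using ie e2 by (intro integral_mono) auto
    hence "expectation (\<lambda>w. (e w)\<^sup>2) \<le> 1 / 4" by (simp add: prob_space power_divide)
    thus "expectation (\<lambda>w. (e w)\<^sup>2) - \<delta>\<^sup>2 \<le> 1 / 4"
      using zero_le_power2[of \<delta>] by linarith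
  qed
  have mean: "expectation (\<lambda>w. c + z w / \<alpha> + e w) = c + \<delta>"
    using z ie by (simp add: \<delta>_def prob_space)
  \<comment> \<open>After expansion the term in \<delta> * z drops out because \<open>z\<close> is
    centred.\<close>
  have "variance (\<lambda>w. c + z w / \<alpha> + e w) =
        expectation (\<lambda>w. (z w)\<^sup>2 / \<alpha>\<^sup>2 + 2 / \<alpha> * (z w * e w) - 2 / \<alpha> * \<delta> * z w + (e w)\<^sup>2 - 2 * \<delta> * e w + \<delta>\<^sup>2)"
    unfolding mean by (intro Bochner_Integration.integral_cong refl)
      (simp add: power2_eq_square algebra_simps)
  also have "\<dots> = pi\<^sup>2 / 6 / \<alpha>\<^sup>2 + 2 / \<alpha> * expectation (\<lambda>w. z w * e w) - 2 / \<alpha> * \<delta> * 0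
                   + expectation (\<lambda>w. (e w)\<^sup>2) - 2 * \<delta> * \<delta> + \<delta>\<^sup>2"
    using z ie ize z2i by (simp add: z2e prob_space \<delta>_def)
  also have "\<dots> = pi\<^sup>2 / (6 * \<alpha>\<^sup>2) + 2 / \<alpha> * expectation (\<lambda>w. z w * e w)
                   + (expectation (\<lambda>w. (e w)\<^sup>2) - \<delta>\<^sup>2)"
    by (simp add: power2_eq_square)
  finally have "variance (\<lambda>w. c + z w / \<alpha> + e w) - pi\<^sup>2 / (6 * \<alpha>\<^sup>2) =
     2 / \<alpha> * expectation (\<lambda>w. z w * e w) + (expectation (\<lambda>w. (e w)\<^sup>2) - \<delta>\<^sup>2)" by simp
  moreover have "\<bar>2 / \<alpha> * expectation (\<lambda>w. z w * e w)\<bar> \<le> 2 * (euler_mascheroni + exp_integral_E1 1) / \<alpha>"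
    using cov \<alpha> by (simp add: abs_mult divide_right_mono)
  ultimately show ?thesis unfolding X using var_e by linarith
qed

text \<open>The integrand lies between 0 and the indicator of Z <= 0, an event of probability exp
  (-1). It is positive exactly when -\<alpha> < Z <= 0, which has positive probability since the
  Gumbel distribution function increases strictly.\<close>

lemma theta_bounds:
  assumes P: "prob_space P" and Z: "gumbel_distributed P Z" and \<alpha>: "\<alpha> > 0"
  shows "0 < theta P Z \<alpha>" "theta P Z \<alpha> < 1"
proof -
  interpret prob_space P by fact
  have [measurable]: "Z \<in> borel_measurable P" using Z by (simp add: gumbel_distributed_def)
  define f where "f = (\<lambda>w. (1 + Z w / \<alpha>)\<^sup>2 * of_bool (0 < 1 + Z w / \<alpha> \<and> 1 + Z w / \<alpha> \<le> 1))"
  have [measurable]: "f \<in> borel_measurable P"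
  proof -
    have "f = (\<lambda>w. if 0 < 1 + Z w / \<alpha> \<and> 1 + Z w / \<alpha> \<le> 1 then (1 + Z w / \<alpha>)\<^sup>2 else 0)"
      by (simp add: f_def fun_eq_iff)
    thus ?thesis by simp
  qed
  have th: "theta P Z \<alpha> = expectation f" by (simp add: theta_def f_def)
  have f0: "0 \<le> f w" for w by (simp add: f_def)
  have f1: "f w \<le> indicator {w \<in> space P. Z w \<le> 0} w" if "w \<in> space P" for w
    using that \<alpha> by (auto simp: f_def divide_le_0_iff power_le_one split: split_indicator)
  have int: "integrable P f"
    by (rule integrable_const_bound[of _ 1]) (use f0 f1 in \<open>auto intro!: order_trans[OF f1] split: split_indicator\<close>)
  have "theta P Z \<alpha> \<le> expectation (indicator {w \<in> space P. Z w \<le> 0})"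
    unfolding th using f1 by (intro integral_mono[OF int] integrable_const_bound[of _ 1]) auto
  also have "\<dots> = exp (- 1)" using gumbel_cdf[OF Z, of 0] by simp
  also have "\<dots> < exp (0::real)" by (subst exp_less_cancel_iff) simp
  finally show "theta P Z \<alpha> < 1" by simp
  have "expectation f \<noteq> 0"
  proof
    assume "expectation f = 0"
    hence "AE w in P. f w = 0"
      using integral_nonneg_eq_0_iff_AE[OF int] f0 by auto
    hence "AE w in P. (Z w \<le> 0) = (Z w \<le> - \<alpha>)"
    proof eventually_elim
      case (elim w)
      thus ?case using \<alpha> by (auto simp: f_def field_simps)
    qed
    hence "prob {w \<in> space P. Z w \<le> 0} = prob {w \<in> space P. Z w \<le> - \<alpha>}"
      by (intro measure_eq_AE) auto
    thus False using gumbel_cdf[OF Z] \<alpha> by simp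
  qed
  moreover have "0 \<le> expectation f" using f0 by simp
  ultimately show "0 < theta P Z \<alpha>" unfolding th by simp
qed

section \<open>Integer-valued random variables\<close>

text \<open>The law of \<open>X\<close> has its point probabilities as density with respect to
  counting measure, so expectations become sums to which dominated convergence applies.\<close>

lemma
  fixes X :: "'a \<Rightarrow> 'b :: countable" and g :: "'b \<Rightarrow> real"
  assumes M: "prob_space M" and [measurable]: "X \<in> M \<rightarrow>\<^sub>M count_space UNIV"
  shows integrable_countable_rv_iff:
      "integrable M (\<lambda>w. g (X w)) \<longleftrightarrow>
       integrable (count_space UNIV) (\<lambda>k. measure M {w \<in> space M. X w = k} * g k)"
    and expectation_countable_rv:
      "(LINT w|M. g (X w)) =
       (LINT k|count_space UNIV. measure M {w \<in> space M. X w = k} * g k)"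
proof -
  interpret prob_space M by fact
  define p where "p = (\<lambda>k. measure M {w \<in> space M. X w = k})"
  have eq: "distr M (count_space UNIV) X = density (count_space UNIV) (\<lambda>k. ennreal (p k))"
  proof (rule measure_eqI_countable[of _ UNIV])
    fix k :: 'b
    have "emeasure (distr M (count_space UNIV) X) {k} = p k"
      by (subst emeasure_distr) (auto simp: p_def emeasure_eq_measure vimage_def Int_def conj_commute)
    also have "\<dots> = emeasure (density (count_space UNIV) (\<lambda>k. ennreal (p k))) {k}"
      by (subst emeasure_density) (auto simp: nn_integral_count_space_indicator[symmetric] max_def)
    finally show "emeasure (distr M (count_space UNIV) X) {k} = \<dots>" .
  qed auto
  have "integrable M (\<lambda>w. g (X w)) \<longleftrightarrow> integrable (distr M (count_space UNIV) X) g"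
    by (subst integrable_distr_eq) auto
  thus "integrable M (\<lambda>w. g (X w)) \<longleftrightarrow>
       integrable (count_space UNIV) (\<lambda>k. measure M {w \<in> space M. X w = k} * g k)"
    unfolding eq p_def by (subst (asm) integrable_density) auto
  have "(LINT w|M. g (X w)) = (LINT k|distr M (count_space UNIV) X. g k)"
    by (subst integral_distr) auto
  thus "(LINT w|M. g (X w)) =
       (LINT k|count_space UNIV. measure M {w \<in> space M. X w = k} * g k)"
    unfolding eq p_def by (subst (asm) integral_density) auto
qed

text \<open>The integers are covered by two half-lines, on each of which the series is
  geometric.\<close>

lemma integrable_exp_abs_int:
  fixes \<beta> :: real
  assumes "\<beta> > 0"
  shows "integrable (count_space UNIV) (\<lambda>k::int. exp (- \<beta> * \<bar>k\<bar>))"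
proof -
  have geo: "integrable (count_space UNIV) (\<lambda>n::nat. exp (- \<beta> * real n))"
  proof -
    have "summable (\<lambda>n. exp (- \<beta>) ^ n)" using assms by (intro summable_geometric) auto
    thus ?thesis
      unfolding integrable_count_space_nat_iff by (simp add: exp_of_nat_mult [symmetric] mult_ac)
  qed
  have 1: "integrable (count_space (range int)) (\<lambda>k::int. exp (- \<beta> * \<bar>k\<bar>))"
    using geo abs_summable_on_reindex_iff[of int UNIV "\<lambda>k. exp (- \<beta> * \<bar>k\<bar>)"]
    by (simp add: abs_summable_on_def)
  have 2: "integrable (count_space (range (\<lambda>n. - int n))) (\<lambda>k::int. exp (- \<beta> * \<bar>k\<bar>))"
    using geo abs_summable_on_reindex_iff[of "\<lambda>n. - int n" UNIV "\<lambda>k. exp (- \<beta> * \<bar>k\<bar>)"]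
    by (simp add: abs_summable_on_def inj_on_def)
  have "range int \<union> range (\<lambda>n. - int n) = UNIV"
    by (auto simp: image_iff) (metis int_cases2)
  thus ?thesis using abs_summable_on_union[of _ "range int" "range (\<lambda>n. - int n)"] 1 2
    by (simp add: abs_summable_on_def)
qed

lemma integrable_square_exp_abs_int:
  fixes \<beta> :: real
  assumes "\<beta> > 0"
  shows "integrable (count_space UNIV) (\<lambda>k::int. exp (- \<beta> * \<bar>k\<bar>) * (real_of_int k)\<^sup>2)"
proof -
  define d where "d = \<beta> / 2"
  have d: "d > 0" using assms by (simp add: d_def)
  have int: "integrable (count_space UNIV) (\<lambda>k::int. 2 / d\<^sup>2 * exp (- d * \<bar>k\<bar>))"
    by (intro integrable_mult_right integrable_exp_abs_int d)
  have le: "exp (- \<beta> * \<bar>k\<bar>) * (real_of_int k)\<^sup>2 \<le> 2 / d\<^sup>2 * exp (- d * \<bar>k\<bar>)" for k :: int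
  proof -
    have "(real_of_int k)\<^sup>2 \<le> 2 / d\<^sup>2 * exp (d * \<bar>k\<bar>)"
      using square_le_exp_abs[OF d, of k] by simp
    hence "exp (- \<beta> * \<bar>k\<bar>) * (real_of_int k)\<^sup>2 \<le> exp (- \<beta> * \<bar>k\<bar>) * (2 / d\<^sup>2 * exp (d * \<bar>k\<bar>))"
      by (intro mult_left_mono) auto
    also have "\<dots> = 2 / d\<^sup>2 * exp (- d * \<bar>k\<bar>)"
      by (simp add: d_def mult_exp_exp)
    finally show ?thesis .
  qed
  show ?thesis
    by (rule Bochner_Integration.integrable_bound[OF int]) (use le in \<open>simp_all add: AE_count_space\<close>)
qed

text \<open>The laws themselves may oscillate; only differences of point probabilities must vanish.
  The common geometric majorant makes the differences of the first and second moments vanish and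
  keeps the moments bounded, so the squared means also become close.\<close>

lemma variance_difference_tendsto_0:
  fixes X :: "nat \<Rightarrow> 'a \<Rightarrow> int" and Y :: "nat \<Rightarrow> 'b \<Rightarrow> int" and C \<beta> :: real
  assumes M: "\<And>n. prob_space (M n)" and N: "\<And>n. prob_space (N n)"
    and X [measurable]: "\<And>n. X n \<in> M n \<rightarrow>\<^sub>M count_space UNIV"
    and Y [measurable]: "\<And>n. Y n \<in> N n \<rightarrow>\<^sub>M count_space UNIV"
    and \<beta>: "\<beta> > 0"
    and bX: "\<And>n k. measure (M n) {w \<in> space (M n). X n w = k} \<le> C * exp (- \<beta> * \<bar>k\<bar>)"
    and bY: "\<And>n k. measure (N n) {w \<in> space (N n). Y n w = k} \<le> C * exp (- \<beta> * \<bar>k\<bar>)"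
    and lim: "\<And>k. (\<lambda>n. measure (M n) {w \<in> space (M n). X n w = k} -
                       measure (N n) {w \<in> space (N n). Y n w = k}) \<longlonglongrightarrow> 0"
  shows "\<And>n. integrable (M n) (\<lambda>w. real_of_int (X n w))"
    and "(\<lambda>n. prob_space.variance (M n) (\<lambda>w. real_of_int (X n w)) -
              prob_space.variance (N n) (\<lambda>w. real_of_int (Y n w))) \<longlonglongrightarrow> 0"
proof -
  define p where "p = (\<lambda>n k. measure (M n) {w \<in> space (M n). X n w = k})"
  define r where "r = (\<lambda>n k. measure (N n) {w \<in> space (N n). Y n w = k})"
  define W where "W = (\<lambda>k::int. C * (exp (- \<beta> * \<bar>k\<bar>) * (real_of_int k)\<^sup>2))"
  have pn: "0 \<le> p n k" "0 \<le> r n k" for n k by (simp_all add: p_def r_def)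
  have C: "C \<ge> 0" using order_trans[OF measure_nonneg bX[of 0 0]] by simp
  have W: "integrable (count_space UNIV) W"
    unfolding W_def by (intro integrable_mult_right integrable_square_exp_abs_int \<beta>)
  have W0: "0 \<le> W k" for k using C by (simp add: W_def)
  have moment:
    "integrable (count_space UNIV) (\<lambda>k. p n k * g k)"
    "integrable (count_space UNIV) (\<lambda>k. r n k * g k)"
    "(\<lambda>n. (LINT k|count_space UNIV. p n k * g k) - (LINT k|count_space UNIV. r n k * g k)) \<longlonglongrightarrow> 0"
    "\<bar>LINT k|count_space UNIV. p n k * g k\<bar> \<le> (LINT k|count_space UNIV. W k)"
    "\<bar>LINT k|count_space UNIV. r n k * g k\<bar> \<le> (LINT k|count_space UNIV. W k)"
    if g: "\<And>k. \<bar>g k\<bar> \<le> (real_of_int k)\<^sup>2" for g n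
  proof -
    have b: "\<bar>p n k * g k\<bar> \<le> W k" "\<bar>r n k * g k\<bar> \<le> W k" for n k
    proof -
      have "\<bar>p n k * g k\<bar> \<le> (C * exp (- \<beta> * \<bar>k\<bar>)) * (real_of_int k)\<^sup>2"
        unfolding abs_mult using bX[of n k] C g[of k] by (intro mult_mono) (auto simp: p_def)
      thus "\<bar>p n k * g k\<bar> \<le> W k" by (simp add: W_def mult_ac)
      have "\<bar>r n k * g k\<bar> \<le> (C * exp (- \<beta> * \<bar>k\<bar>)) * (real_of_int k)\<^sup>2"
        unfolding abs_mult using bY[of n k] C g[of k] by (intro mult_mono) (auto simp: r_def)
      thus "\<bar>r n k * g k\<bar> \<le> W k" by (simp add: W_def mult_ac)
    qed
    have int: "integrable (count_space UNIV) (\<lambda>k. p n k * g k)"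
      "integrable (count_space UNIV) (\<lambda>k. r n k * g k)" for n
      by (rule Bochner_Integration.integrable_bound[OF W]; use b W0 in \<open>simp add: abs_of_nonneg\<close>)+
    show "integrable (count_space UNIV) (\<lambda>k. p n k * g k)"
      "integrable (count_space UNIV) (\<lambda>k. r n k * g k)" by (fact int)+
    show "\<bar>LINT k|count_space UNIV. p n k * g k\<bar> \<le> (LINT k|count_space UNIV. W k)"
      using b(1) by (intro order_trans[OF integral_abs_bound] integral_mono int integrable_abs W) auto
    show "\<bar>LINT k|count_space UNIV. r n k * g k\<bar> \<le> (LINT k|count_space UNIV. W k)"
      using b(2) by (intro order_trans[OF integral_abs_bound] integral_mono int integrable_abs W) auto
    have "(\<lambda>n. LINT k|count_space UNIV. p n k * g k - r n k * g k) \<longlonglongrightarrow> (LINT k|count_space (UNIV::int set). 0)"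
    proof (rule integral_dominated_convergence)
      show "integrable (count_space UNIV) (\<lambda>k. W k + W k)" by (intro Bochner_Integration.integrable_add W)
      show "AE k in count_space UNIV. norm (p n k * g k - r n k * g k) \<le> W k + W k" for n
        unfolding real_norm_def by (intro AE_I2 order_trans[OF abs_triangle_ineq4] add_mono b)
      have "(\<lambda>n. (p n k - r n k) * g k) \<longlonglongrightarrow> 0 * g k" for k
        using lim[of k] by (intro tendsto_mult tendsto_const) (simp add: p_def r_def)
      thus "AE k in count_space UNIV. (\<lambda>n. p n k * g k - r n k * g k) \<longlonglongrightarrow> 0"
        by (simp add: left_diff_distrib)
    qed auto
    thus "(\<lambda>n. (LINT k|count_space UNIV. p n k * g k) - (LINT k|count_space UNIV. r n k * g k)) \<longlonglongrightarrow> 0"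
      using int by simp
  qed
  \<comment> \<open>On the integers |k| <= k^2, so the first moment is covered by the majorant of
    the second.\<close>
  have g1: "\<bar>real_of_int k\<bar> \<le> (real_of_int k)\<^sup>2" for k
  proof -
    have "\<bar>k\<bar> \<le> \<bar>k\<bar> * \<bar>k\<bar>" using mult_right_mono[of 1 "\<bar>k\<bar>" "\<bar>k\<bar>"] by (cases "k = 0") simp_all
    hence "real_of_int \<bar>k\<bar> \<le> real_of_int (\<bar>k\<bar> * \<bar>k\<bar>)" by (simp only: of_int_le_iff)
    thus ?thesis by (simp add: power2_eq_square)
  qed
  have g2: "\<bar>(real_of_int k)\<^sup>2\<bar> \<le> (real_of_int k)\<^sup>2" for k by simp
  show "integrable (M n) (\<lambda>w. real_of_int (X n w))" for n
    using integrable_countable_rv_iff[OF M X, where g = real_of_int] moment(1)[OF g1]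
    by (simp add: p_def)
  define p1 p2 r1 r2
    where "p1 = (\<lambda>n. LINT k|count_space UNIV. p n k * real_of_int k)"
      and "p2 = (\<lambda>n. LINT k|count_space UNIV. p n k * (real_of_int k)\<^sup>2)"
      and "r1 = (\<lambda>n. LINT k|count_space UNIV. r n k * real_of_int k)"
      and "r2 = (\<lambda>n. LINT k|count_space UNIV. r n k * (real_of_int k)\<^sup>2)"
  have varX: "prob_space.variance (M n) (\<lambda>w. real_of_int (X n w)) = p2 n - (p1 n)\<^sup>2" for n
    using integrable_countable_rv_iff[OF M X, where g = real_of_int] expectation_countable_rv[OF M X, where g = real_of_int]
      integrable_countable_rv_iff[OF M X, where g = "\<lambda>k. (real_of_int k)\<^sup>2"]
      expectation_countable_rv[OF M X, where g = "\<lambda>k. (real_of_int k)\<^sup>2"] moment(1)[OF g1] moment(1)[OF g2]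
    by (subst prob_space.variance_eq[OF M]) (auto simp: p1_def p2_def p_def)
  have varY: "prob_space.variance (N n) (\<lambda>w. real_of_int (Y n w)) = r2 n - (r1 n)\<^sup>2" for n
    using integrable_countable_rv_iff[OF N Y, where g = real_of_int] expectation_countable_rv[OF N Y, where g = real_of_int]
      integrable_countable_rv_iff[OF N Y, where g = "\<lambda>k. (real_of_int k)\<^sup>2"]
      expectation_countable_rv[OF N Y, where g = "\<lambda>k. (real_of_int k)\<^sup>2"] moment(2)[OF g1] moment(2)[OF g2]
    by (subst prob_space.variance_eq[OF N]) (auto simp: r1_def r2_def r_def)
  have d1: "(\<lambda>n. p1 n - r1 n) \<longlonglongrightarrow> 0" unfolding p1_def r1_def by (rule moment(3)[OF g1])
  have d2: "(\<lambda>n. p2 n - r2 n) \<longlonglongrightarrow> 0" unfolding p2_def r2_def by (rule moment(3)[OF g2])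
  \<comment> \<open>The difference of the squared means factors as (p1 - r1)(p1 + r1), a null
    sequence times a sequence bounded by 2B.\<close>
  define B where "B = (LINT k|count_space UNIV. W k)"
  have "\<bar>p1 n + r1 n\<bar> \<le> 2 * B" for n
    using moment(4)[OF g1, of n] moment(5)[OF g1, of n] unfolding p1_def r1_def B_def by linarith
  hence "(\<lambda>n. (p1 n - r1 n) * (p1 n + r1 n)) \<longlonglongrightarrow> 0"
    by (intro lim_null_mult_right_bounded[OF d1, of _ "2 * B"]) auto
  from tendsto_diff[OF d2 this]
  show "(\<lambda>n. prob_space.variance (M n) (\<lambda>w. real_of_int (X n w)) -
              prob_space.variance (N n) (\<lambda>w. real_of_int (Y n w))) \<longlonglongrightarrow> 0"
    unfolding varX varY by (simp add: power2_eq_square algebra_simps)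
qed

lemma int_rv_point_prob:
  fixes X :: "'a \<Rightarrow> int"
  assumes M: "prob_space M" and [measurable]: "X \<in> M \<rightarrow>\<^sub>M count_space UNIV"
  shows "measure M {w \<in> space M. X w = k} =
         measure M {w \<in> space M. X w \<le> k} - measure M {w \<in> space M. X w \<le> k - 1}"
proof -
  interpret prob_space M by fact
  have "{w \<in> space M. X w = k} = {w \<in> space M. X w \<le> k} - {w \<in> space M. X w \<le> k - 1}" by auto
  also have "prob \<dots> = prob {w \<in> space M. X w \<le> k} - prob {w \<in> space M. X w \<le> k - 1}"
    by (rule finite_measure_Diff) auto
  finally show ?thesis .
qed

text \<open>The point probability at k is at most P(X > k - 1), used for k >= 1, and at most P(X <=
  k), used for k <= 0.\<close>

lemma int_rv_point_prob_le_geometric: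
  fixes X :: "'a \<Rightarrow> int" and C \<beta> :: real
  assumes M: "prob_space M" and X: "X \<in> M \<rightarrow>\<^sub>M count_space UNIV"
    and up: "k \<ge> 1 \<Longrightarrow> 1 - measure M {w \<in> space M. X w \<le> k - 1} \<le> C * exp (- \<beta> * k)"
    and lo: "k \<le> 0 \<Longrightarrow> measure M {w \<in> space M. X w \<le> k} \<le> C * exp (\<beta> * k)"
  shows "measure M {w \<in> space M. X w = k} \<le> C * exp (- \<beta> * \<bar>k\<bar>)"
proof -
  interpret prob_space M by fact
  note pt = int_rv_point_prob[OF M X, of k]
  show ?thesis
  proof (cases "k \<ge> 1")
    case True
    have "prob {w \<in> space M. X w = k} \<le> C * exp (- \<beta> * k)"
      using up[OF True] prob_le_1[of "{w \<in> space M. X w \<le> k}"] pt by linarith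
    with True show ?thesis by simp
  next
    case False
    hence "k \<le> 0" by simp
    have "prob {w \<in> space M. X w = k} \<le> C * exp (\<beta> * k)"
      using lo[OF \<open>k \<le> 0\<close>] measure_nonneg[of M "{w \<in> space M. X w \<le> k - 1}"] pt by linarith
    with False show ?thesis by simp
  qed
qed

section \<open>Tails of the coupon collector's time\<close>

abbreviation draws :: "nat \<Rightarrow> nat stream measure" where
  "draws a \<equiv> stream_space (measure_pmf (pmf_of_set {..<a}))"

lemma measurable_snth_draws [measurable]:
  "(\<lambda>\<omega>. \<omega> !! i) \<in> draws a \<rightarrow>\<^sub>M count_space UNIV"
  using measurable_snth[of i "measure_pmf (pmf_of_set {..<a})"]
  by (simp add: measurable_cong_sets[OF refl sets_measure_pmf_count_space])

lemma space_draws [simp]: "space (draws a) = UNIV"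
  by (simp add: space_stream_space)

lemma prob_space_draws: "prob_space (draws a)"
  by (intro prob_space.prob_space_stream_space measure_pmf.prob_space_axioms)

lemma prob_space_coupon_law: "prob_space (coupon_law a)"
  unfolding coupon_law_def by (intro prob_space.prob_space_distr prob_space_draws) simp

text \<open>Induction on n, conditioning on the first draw: the remaining stream has the same
  law.\<close>

lemma measure_draws_all_in:
  "measure (draws a) {\<omega>. \<forall>i<n. \<omega> !! i \<in> S} = measure (pmf_of_set {..<a}) S ^ n"
proof (induction n)
  case 0
  then show ?case using prob_space.prob_space[OF prob_space_draws[of a]] by simp
next
  case (Suc n)
  interpret D: prob_space "draws a" by (rule prob_space_draws)
  let ?p = "pmf_of_set {..<a}"
  let ?E = "\<lambda>n. {\<omega>::nat stream. \<forall>i<n. \<omega> !! i \<in> S}"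
  have m: "?E n \<in> sets (draws a)" for n
  proof -
    have "{\<omega> \<in> space (draws a). \<forall>i\<in>{..<n}. \<omega> !! i \<in> S} \<in> sets (draws a)" by measurable
    also have "{\<omega> \<in> space (draws a). \<forall>i\<in>{..<n}. \<omega> !! i \<in> S} = ?E n" by auto
    finally show ?thesis .
  qed
  have "emeasure (draws a) (?E (Suc n)) =
        (\<integral>\<^sup>+t. emeasure (draws a) {x \<in> space (draws a). t ## x \<in> ?E (Suc n)} \<partial>?p)"
    by (rule prob_space.emeasure_stream_space[OF measure_pmf.prob_space_axioms m])
  also have "\<dots> = (\<integral>\<^sup>+t. emeasure (draws a) (?E n) * indicator S t \<partial>?p)"
    by (intro nn_integral_cong) (auto simp: All_less_Suc2 split: split_indicator)
  also have "\<dots> = emeasure (draws a) (?E n) * emeasure ?p S"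
    by (simp add: nn_integral_cmult_indicator)
  finally show ?case
    using Suc by (simp add: D.emeasure_eq_measure measure_pmf.emeasure_eq_measure flip: ennreal_mult)
qed

lemma prob_coupons_missed:
  assumes "J \<subseteq> {..<a}" "a > 0"
  shows "measure (draws a) {\<omega>. \<forall>i<n. \<omega> !! i \<notin> J} = (1 - real (card J) / real a) ^ n"
proof -
  have "measure (pmf_of_set {..<a}) (- J) = real (card ({..<a} - J)) / real a"
    using assms by (subst measure_pmf_of_set) (auto simp: Diff_eq lessThan_empty_iff)
  also have "\<dots> = 1 - real (card J) / real a"
    using assms card_mono[OF _ assms(1)] finite_subset[OF assms(1)]
    by (simp add: card_Diff_subset of_nat_diff field_simps)
  finally show ?thesis using measure_draws_all_in[of a n "- J"] by simp
qed

section \<open>Missing types and inclusion-exclusion for the collector's tail\<close>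

definition unseen :: "nat \<Rightarrow> nat \<Rightarrow> nat stream set" where
  "unseen n k = {\<omega>. \<forall>i<n. \<omega> !! i \<noteq> k}"

lemma sets_unseen [measurable]: "unseen n k \<in> sets (draws a)"
proof -
  have "{\<omega> \<in> space (draws a). \<forall>i\<in>{..<n}. \<omega> !! i \<noteq> k} \<in> sets (draws a)" by measurable
  also have "{\<omega> \<in> space (draws a). \<forall>i\<in>{..<n}. \<omega> !! i \<noteq> k} = unseen n k"
    by (auto simp: unseen_def)
  finally show ?thesis .
qed

lemma prob_unseen: "k < a \<Longrightarrow> measure (draws a) (unseen n k) = (1 - 1 / real a) ^ n"
  using prob_coupons_missed[of "{k}" a n] by (simp add: unseen_def)

lemma prob_unseen_pair:
  assumes "k < a" "l < a" "k \<noteq> l"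
  shows "measure (draws a) (unseen n k \<inter> unseen n l) = (1 - 2 / real a) ^ n"
proof -
  have "unseen n k \<inter> unseen n l = {\<omega>. \<forall>i<n. \<omega> !! i \<notin> {k, l}}"
    by (auto simp: unseen_def)
  also have "measure (draws a) \<dots> = (1 - real (card {k, l}) / real a) ^ n"
    by (rule prob_coupons_missed) (use assms in auto)
  finally show ?thesis using assms by simp
qed

text \<open>The equivalence is claimed almost everywhere because \<open>LEAST\<close> is unspecified
  when some type never appears.\<close>

lemma coupon_time_greater_AE:
  assumes "a > 0"
  shows "AE \<omega> in draws a. coupon_time a \<omega> > n \<longleftrightarrow> \<omega> \<in> (\<Union>k<a. unseen n k)"
proof -
  interpret D: prob_space "draws a" by (rule prob_space_draws)
  have seen: "{..<a} \<subseteq> set (stake n \<omega>) \<longleftrightarrow> \<omega> \<notin> (\<Union>k<a. unseen n k)" for n \<omega>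
    by (force simp: set_conv_nth subset_eq unseen_def)
  \<comment> \<open>Never drawing k has probability at most (1 - 1/a)^n for every n, hence
    0.\<close>
  have "AE \<omega> in draws a. \<exists>n. \<omega> \<notin> unseen n k" if k: "k < a" for k
  proof -
    have "measure (draws a) (\<Inter>n. unseen n k) \<le> (1 - 1 / real a) ^ n" for n
      by (subst prob_unseen[OF k, symmetric], rule D.finite_measure_mono) auto
    moreover have "(\<lambda>n. (1 - 1 / real a) ^ n) \<longlonglongrightarrow> 0"
      using assms by (intro LIMSEQ_power_zero) (auto simp: field_simps abs_if)
    ultimately have "measure (draws a) (\<Inter>n. unseen n k) \<le> 0"
      by (intro LIMSEQ_le_const) auto
    hence "measure (draws a) (\<Inter>n. unseen n k) = 0"
      using measure_nonneg order_antisym by blast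
    hence "AE \<omega> in draws a. \<omega> \<notin> (\<Inter>n. unseen n k)"
      by (intro AE_not_in null_setsI) (auto simp: D.emeasure_eq_measure)
    thus ?thesis by auto
  qed
  hence "AE \<omega> in draws a. \<forall>k\<in>{..<a}. \<exists>n. \<omega> \<notin> unseen n k"
    by (subst AE_ball_countable) auto
  thus ?thesis
  proof eventually_elim
    case (elim \<omega>)
    have mono: "unseen n' k \<subseteq> unseen n k" if "n \<le> n'" for n n' k
      unfolding unseen_def using that by (auto dest: less_le_trans)
    from elim obtain f where f: "\<And>k. k < a \<Longrightarrow> \<omega> \<notin> unseen (f k) k"
      by (metis lessThan_iff)
    \<comment> \<open>By time \<open>m\<close> every type has been seen, so the set whose least
      element is taken is nonempty.\<close>
    define m where "m = Max (f ` {..<a})"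
    have "{..<a} \<subseteq> set (stake m \<omega>)"
      unfolding seen
    proof
      assume "\<omega> \<in> (\<Union>k<a. unseen m k)"
      then obtain k where k: "k < a" "\<omega> \<in> unseen m k" by auto
      have "f k \<le> m" unfolding m_def using k by (intro Max_ge) auto
      with mono[OF this] f k show False by blast
    qed
    define L where "L = coupon_time a \<omega>"
    have L: "{..<a} \<subseteq> set (stake L \<omega>)" unfolding L_def coupon_time_def
      by (rule LeastI) fact
    have "L > n \<longleftrightarrow> \<not> {..<a} \<subseteq> set (stake n \<omega>)"
    proof
      show "\<not> {..<a} \<subseteq> set (stake n \<omega>)" if "L > n"
        using that unfolding L_def coupon_time_def by (rule not_less_Least)
      show "L > n" if "\<not> {..<a} \<subseteq> set (stake n \<omega>)"
      proof (rule ccontr)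
        assume "\<not> n < L"
        hence "unseen n k \<subseteq> unseen L k" for k by (intro mono) simp
        thus False using that L unfolding seen by blast
      qed
    qed
    thus ?case unfolding seen L_def by simp
  qed
qed

lemma coupon_law_tail_eq:
  assumes "a > 0"
  shows "measure (coupon_law a) {n<..} = measure (draws a) (\<Union>k<a. unseen n k)"
proof -
  interpret D: prob_space "draws a" by (rule prob_space_draws)
  have "measure (coupon_law a) {n<..} = measure (draws a) {\<omega>. n < coupon_time a \<omega>}"
    unfolding coupon_law_def by (subst measure_distr) (auto simp: vimage_def)
  also have "\<dots> = measure (draws a) (\<Union>k<a. unseen n k)"
  proof (rule measure_eq_AE)
    have "{\<omega> \<in> space (draws a). n < coupon_time a \<omega>} \<in> sets (draws a)" by measurable
    thus "{\<omega>. n < coupon_time a \<omega>} \<in> sets (draws a)" by simp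
  qed (use coupon_time_greater_AE[OF assms, of n] in auto)
  finally show ?thesis .
qed

lemma coupon_law_tail_upper:
  assumes "a > 0"
  shows "measure (coupon_law a) {n<..} \<le> real a * (1 - 1 / real a) ^ n"
proof -
  interpret D: prob_space "draws a" by (rule prob_space_draws)
  have "measure (draws a) (\<Union>k<a. unseen n k) \<le> (\<Sum>k<a. measure (draws a) (unseen n k))"
    by (rule D.finite_measure_subadditive_finite) auto
  also have "\<dots> = real a * (1 - 1 / real a) ^ n" by (simp add: prob_unseen)
  finally show ?thesis using coupon_law_tail_eq[OF assms] by simp
qed

text \<open>Only type 0 is considered. The estimate is crude by a factor of at most a, but for a >=
  2 it is positive for every n, while the exclusive bound below is a(2 - a) <= 0 at n = 0; it serves
  for the left tail of the maximum.\<close>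

lemma coupon_law_tail_lower:
  assumes "a > 0"
  shows "(1 - 1 / real a) ^ n \<le> measure (coupon_law a) {n<..}"
proof -
  interpret D: prob_space "draws a" by (rule prob_space_draws)
  have "measure (draws a) (unseen n 0) \<le> measure (draws a) (\<Union>k<a. unseen n k)"
    using assms by (intro D.finite_measure_mono) auto
  thus ?thesis using coupon_law_tail_eq[OF assms] prob_unseen[OF assms] by simp
qed

text \<open>Only the events that exactly one given type is missing are counted; they are disjoint.\<close>
lemma coupon_law_tail_lower_exclusive:
  assumes "a > 0"
  shows "real a * (1 - 1 / real a) ^ n - real a * (real a - 1) * (1 - 2 / real a) ^ n
           \<le> measure (coupon_law a) {n<..}"
proof -
  interpret D: prob_space "draws a" by (rule prob_space_draws)
  define U where "U = (\<lambda>k. \<Union>l\<in>{..<a} - {k}. unseen n l)"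
  have [measurable]: "U k \<in> sets (draws a)" for k unfolding U_def by (intro sets.finite_UN) auto
  have "(1 - 1 / real a) ^ n - (real a - 1) * (1 - 2 / real a) ^ n
          \<le> measure (draws a) (unseen n k - U k)" if k: "k < a" for k
  proof -
    have "measure (draws a) (unseen n k \<inter> U k) =
          measure (draws a) (\<Union>l\<in>{..<a} - {k}. unseen n k \<inter> unseen n l)"
      by (rule arg_cong[where f = "measure (draws a)"]) (auto simp: U_def)
    also have "\<dots> \<le> (\<Sum>l\<in>{..<a} - {k}. measure (draws a) (unseen n k \<inter> unseen n l))"
      by (rule D.finite_measure_subadditive_finite) auto
    also have "\<dots> = (real a - 1) * (1 - 2 / real a) ^ n"
      using k by (simp add: prob_unseen_pair of_nat_diff)
    finally show ?thesis
      using D.finite_measure_Diff'[of "unseen n k" "U k"] prob_unseen[OF k, of n] by simp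
  qed
  hence "(\<Sum>k<a. (1 - 1 / real a) ^ n - (real a - 1) * (1 - 2 / real a) ^ n)
          \<le> (\<Sum>k<a. measure (draws a) (unseen n k - U k))"
    by (intro sum_mono) auto
  also have "\<dots> = measure (draws a) (\<Union>k<a. unseen n k - U k)"
    by (intro D.finite_measure_finite_Union [symmetric])
       (auto simp: disjoint_family_on_def U_def)
  also have "\<dots> \<le> measure (draws a) (\<Union>k<a. unseen n k)"
    by (intro D.finite_measure_mono) auto
  finally show ?thesis
    using coupon_law_tail_eq[OF assms, of n] by (simp add: algebra_simps)
qed

section \<open>The maximum of independent collectors\<close>

lemma prob_Max_le_iid:
  fixes Y :: "nat \<Rightarrow> 'a \<Rightarrow> nat"
  assumes M: "prob_space M" and q: "1 \<le> q"
    and ind: "prob_space.indep_vars M (\<lambda>_. count_space UNIV) Y {1..q}"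
    and law: "\<And>i. i \<in> {1..q} \<Longrightarrow> distr M (count_space UNIV) (Y i) = D"
  shows "measure M {w \<in> space M. (MAX i\<in>{1..q}. Y i w) \<le> n} = (1 - measure D {n<..}) ^ q"
proof -
  interpret prob_space M by fact
  have Y: "Y i \<in> M \<rightarrow>\<^sub>M count_space UNIV" if "i \<in> {1..q}" for i
    using ind that by (auto simp: indep_vars_def)
  have "{w \<in> space M. (MAX i\<in>{1..q}. Y i w) \<le> n} = (\<Inter>i\<in>{1..q}. Y i -` {..n} \<inter> space M)"
    using q by (auto simp: Max_le_iff)
  also have "prob \<dots> = (\<Prod>i\<in>{1..q}. prob (Y i -` {..n} \<inter> space M))"
    using q by (intro indep_varsD_finite[OF ind]) auto
  also have "\<dots> = (\<Prod>i\<in>{1..q}. 1 - measure D {n<..})"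
  proof (rule prod.cong [OF refl])
    fix i assume i: "i \<in> {1..q}"
    interpret D: prob_space D unfolding law[OF i, symmetric] by (rule prob_space_distr[OF Y[OF i]])
    have DU: "space D = UNIV" "sets D = UNIV" unfolding law[OF i, symmetric] by simp_all
    have "prob (Y i -` {..n} \<inter> space M) = measure D {..n}"
      unfolding law[OF i, symmetric] by (rule measure_distr [symmetric]) (rule Y[OF i], simp)
    also have "\<dots> = measure D (space D - {n<..})" by (rule arg_cong[where f = "measure D"]) (auto simp: DU)
    also have "\<dots> = 1 - measure D {n<..}" by (rule D.prob_compl) (simp add: DU)
    finally show "prob (Y i -` {..n} \<inter> space M) = 1 - measure D {n<..}" .
  qed
  finally show ?thesis by simp
qed

text \<open>Since exp r >= 1 + r, it suffices that (1 - r + r^2)(1 + r) = 1 + r^3 >= 1.\<close>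

lemma exp_neg_le_quadratic:
  fixes r :: real
  assumes "r \<ge> 0"
  shows "exp (- r) \<le> 1 - r + r\<^sup>2"
proof -
  have "1 \<le> (1 - r + r\<^sup>2) * (1 + r)"
    using zero_le_power[OF assms, of 3] by (simp add: power2_eq_square power3_eq_cube algebra_simps)
  also have "\<dots> \<le> (1 - r + r\<^sup>2) * exp r"
    using exp_ge_add_one_self[of r] zero_le_power2[of "r - 1 / 2"]
    by (intro mult_left_mono) (auto simp: power2_eq_square algebra_simps)
  finally show ?thesis by (simp add: exp_minus field_simps)
qed

text \<open>For numbers in [0, 1], q-th powers differ by at most q times the difference of the
  bases. Replacing p by r = a \<rho>^n costs at most (a - 1) \<sigma>^n r by inclusion-exclusion, as
  1 - 2/a = \<rho> \<sigma>; replacing 1 - r by exp (-r) costs at most r^2.\<close>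

lemma coupon_maximum_cdf_approx:
  fixes a n q :: nat
  assumes a: "a \<ge> 2"
  defines "p \<equiv> measure (coupon_law a) {n<..}"
    and "\<rho> \<equiv> 1 - 1 / real a" and "\<sigma> \<equiv> (real a - 2) / (real a - 1)"
  defines "u \<equiv> real q * real a * \<rho> ^ n"
  shows "\<bar>(1 - p) ^ q - exp (- u)\<bar> \<le> u * ((real a - 1) * \<sigma> ^ n + real a * \<rho> ^ n)"
proof -
  define r where "r = real a * \<rho> ^ n"
  have \<rho>: "0 < \<rho>" "\<rho> < 1" using a by (auto simp: \<rho>_def field_simps)
  have r0: "r \<ge> 0" using \<rho> by (simp add: r_def)
  have p: "p \<le> r" "r - p \<le> real a * (real a - 1) * (1 - 2 / real a) ^ n"
    using coupon_law_tail_upper[of a n] coupon_law_tail_lower_exclusive[of a n] a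
    by (simp_all add: p_def r_def \<rho>_def)
  have p01: "0 \<le> p" "p \<le> 1"
    by (simp_all add: p_def prob_space.prob_le_1[OF prob_space_coupon_law])
  have "1 - 2 / real a = \<sigma> * \<rho>" using a by (simp add: \<sigma>_def \<rho>_def field_simps)
  hence rp: "r - p \<le> (real a - 1) * \<sigma> ^ n * r"
    using p(2) by (simp add: power_mult_distrib r_def mult_ac)
  have "exp (- u) = exp (- r) ^ q"
    by (simp add: u_def r_def flip: exp_of_nat_mult)
  hence "\<bar>(1 - p) ^ q - exp (- u)\<bar> \<le> real q * \<bar>(1 - p) - exp (- r)\<bar>"
    using norm_power_diff[of "1 - p" "exp (- r)" q] p01 r0 by simp
  also have "\<dots> \<le> real q * ((real a - 1) * \<sigma> ^ n * r + r\<^sup>2)"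
    using exp_neg_le_quadratic[OF r0] exp_ge_add_one_self[of "- r"] p(1) rp
    by (intro mult_left_mono) (auto simp: abs_le_iff)
  also have "\<dots> = u * ((real a - 1) * \<sigma> ^ n + real a * \<rho> ^ n)"
    by (simp add: u_def r_def power2_eq_square algebra_simps)
  finally show ?thesis .
qed

text \<open>Right tail: Bernoulli's inequality and the union bound. Left tail: 1 - p <= exp
  (-\<rho>^n) and exp (-v) <= 1/v with v = q \<rho>^n = u/a.\<close>

lemma coupon_maximum_cdf_tails:
  fixes a n q :: nat
  assumes a: "a \<ge> 2" and q: "q \<ge> 1"
  defines "p \<equiv> measure (coupon_law a) {n<..}"
    and "\<rho> \<equiv> 1 - 1 / real a"
  defines "u \<equiv> real q * real a * \<rho> ^ n"
  shows "1 - (1 - p) ^ q \<le> u" "(1 - p) ^ q \<le> real a / u"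
proof -
  have \<rho>: "0 < \<rho>" "\<rho> < 1" using a by (auto simp: \<rho>_def field_simps)
  have p: "p \<le> real a * \<rho> ^ n" "\<rho> ^ n \<le> p"
    using coupon_law_tail_upper[of a n] coupon_law_tail_lower[of a n] a
    by (simp_all add: p_def \<rho>_def)
  have p01: "0 \<le> p" "p \<le> 1"
    by (simp_all add: p_def prob_space.prob_le_1[OF prob_space_coupon_law])
  have "1 - (1 - p) ^ q \<le> real q * p"
    using Bernoulli_inequality[of "- p" q] p01 by simp
  also have "\<dots> \<le> u" using mult_left_mono[OF p(1), of "real q"] by (simp add: u_def mult_ac)
  finally show "1 - (1 - p) ^ q \<le> u" .
  have pos: "0 < real q * \<rho> ^ n" using q \<rho> by simp
  have "(1 - p) ^ q \<le> exp (- (\<rho> ^ n)) ^ q"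
    using p01 p(2) exp_ge_add_one_self[of "- (\<rho> ^ n)"] by (intro power_mono) auto
  also have "\<dots> = inverse (exp (real q * \<rho> ^ n))"
    by (simp add: exp_minus exp_of_nat_mult power_inverse)
  also have "\<dots> \<le> inverse (real q * \<rho> ^ n)"
    using pos exp_ge_add_one_self[of "real q * \<rho> ^ n"] by (intro le_imp_inverse_le) linarith+
  also have "\<dots> = real a / u" using a by (simp add: u_def field_simps)
  finally show "(1 - p) ^ q \<le> real a / u" .
qed

theorem theorem4p5:
  fixes a :: nat
    and \<alpha> :: real
    and M :: "nat \<Rightarrow> 'w measure"
    and Y :: "nat \<Rightarrow> nat \<Rightarrow> 'w \<Rightarrow> nat"
    and N :: "nat \<Rightarrow> 'w \<Rightarrow> nat"
    and P :: "'z measure"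
    and Z :: "'z \<Rightarrow> real"
  assumes "2 \<le> a"
    and "\<alpha> = ln (real a / (real a - 1))"
    and "\<And>q. 1 \<le> q \<Longrightarrow> prob_space (M q)"
    and "\<And>q. 1 \<le> q \<Longrightarrow> prob_space.indep_vars (M q) (\<lambda>_. count_space UNIV) (Y q) {1..q}"
    and "\<And>q i. i \<in> {1..q} \<Longrightarrow> distr (M q) (count_space UNIV) (Y q i) = coupon_law a"
    and "\<And>q w. 1 \<le> q \<Longrightarrow> N q w = (MAX i\<in>{1..q}. Y q i w)"
    and "prob_space P"
    and "gumbel_distributed P Z"
  shows "limsup (\<lambda>q. ereal \<bar>prob_space.variance (M q) (\<lambda>w. real (N q w)) - pi\<^sup>2 / (6 * \<alpha>\<^sup>2)\<bar>)
           \<le> ereal (theta P Z \<alpha> + 1 - exp (- 1)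
                    + 2 * (euler_mascheroni + exp_integral_E1 1) / \<alpha>)
         \<and> 0 < theta P Z \<alpha> \<and> theta P Z \<alpha> < 1"
proof -
  note a = assms(1) and P = assms(7) and Z = assms(8)
  have [measurable]: "Z \<in> borel_measurable P" using Z by (simp add: gumbel_distributed_def)
  interpret P: prob_space P by fact
  have \<alpha>: "\<alpha> > 0" using a assms(2) by simp
  define \<rho> where "\<rho> = 1 - 1 / real a"
  have \<rho>: "0 < \<rho>" "\<rho> < 1" using a by (auto simp: \<rho>_def field_simps)
  have \<rho>_pow: "\<rho> ^ n = exp (- \<alpha> * real n)" for n
  proof -
    have "\<rho> = inverse (real a / (real a - 1))" using a by (simp add: \<rho>_def field_simps)
    also have "\<dots> = exp (- \<alpha>)" using a by (simp add: assms(2) exp_minus)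
    finally show ?thesis by (simp add: mult_ac flip: exp_of_nat_mult)
  qed
  \<comment> \<open>All sequences are indexed from 0 with q standing for q + 1 questions, since
    nothing is assumed for zero questions. \<open>b\<close> solves (q + 1) a exp (-\<alpha> b) =
    1.\<close>
  define b where "b = (\<lambda>q. ln (real a * real (Suc q)) / \<alpha>)"
  define m where "m = (\<lambda>q. \<lceil>b q\<rceil>)"
  \<comment> \<open>The Gumbel coordinate of the integer point m + k. Centring at an integer keeps
    it in [\<alpha>k, \<alpha>(k + 1)] for all q, which makes the later bounds uniform.\<close>
  define x where "x = (\<lambda>q k. \<alpha> * (real_of_int (m q + k) - b q))"
  define F where "F = (\<lambda>q n. (1 - measure (coupon_law a) {n<..}) ^ Suc q)"
  define K where "K = (\<lambda>q w. int (N (Suc q) w) - m q)"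
  define L where "L = (\<lambda>q w. \<lceil>b q + Z w / \<alpha>\<rceil> - m q)"
  define FK where "FK = (\<lambda>q k. measure (M (Suc q)) {w \<in> space (M (Suc q)). K q w \<le> k})"
  define FL where "FL = (\<lambda>q k. measure P {w \<in> space P. L q w \<le> k})"

  have b0: "0 \<le> b q" for q
    using a \<alpha> mult_mono[of 1 "real a" 1 "real (Suc q)"] by (auto simp: b_def)
  have m0: "0 \<le> m q" for q using b0[of q] unfolding m_def by linarith
  have mb: "b q \<le> m q" "m q \<le> b q + 1" for q unfolding m_def by linarith+
  have x_bounds: "\<alpha> * k \<le> x q k" "x q k \<le> \<alpha> * (k + 1)" for q and k :: int
    unfolding x_def using \<alpha> mb[of q] by (auto intro!: mult_left_mono)
  \<comment> \<open>At n = m + k the quantity u of the estimates for the maximum is exp (-x),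
    because \<rho> = exp (-\<alpha>) and exp (\<alpha> b) = a(q + 1).\<close>
  have u_eq: "real (Suc q) * real a * \<rho> ^ nat (m q + k) = exp (- x q k)" if "0 \<le> m q + k" for q k
  proof -
    have "exp (- x q k) = exp (\<alpha> * b q) * exp (- \<alpha> * real (nat (m q + k)))"
      using that by (simp add: x_def algebra_simps mult_exp_exp)
    also have "exp (\<alpha> * b q) = real a * real (Suc q)"
      using \<alpha> a by (simp add: b_def del: of_nat_Suc)
    finally show ?thesis by (simp add: \<rho>_pow mult_ac)
  qed

  \<comment> \<open>Measurability and the two distribution functions\<close>
  have meas_Y: "Y (Suc q) i \<in> M (Suc q) \<rightarrow>\<^sub>M count_space UNIV" if "i \<in> {1..Suc q}" for q i
  proof -
    have "prob_space.indep_vars (M (Suc q)) (\<lambda>_. count_space UNIV) (Y (Suc q)) {1..Suc q}"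
      by (rule assms(4)) simp
    hence "\<forall>i\<in>{1..Suc q}. Y (Suc q) i \<in> M (Suc q) \<rightarrow>\<^sub>M count_space UNIV"
      by (subst (asm) prob_space.indep_vars_def2[OF assms(3)]) simp_all
    with that show ?thesis by blast
  qed
  have meas_N: "N (Suc q) \<in> M (Suc q) \<rightarrow>\<^sub>M count_space UNIV" for q
  proof -
    have pred: "Measurable.pred (M (Suc q)) (\<lambda>w. \<exists>i\<in>{1..Suc q}. Y (Suc q) i w = n)" for n
      using meas_Y[of _ q] by (intro pred_intros_finite) (auto intro: pred_eq_const1)
    have "N (Suc q) = (\<lambda>w. Max {n. \<exists>i\<in>{1..Suc q}. Y (Suc q) i w = n})"
    proof
      fix w
      have "(\<lambda>i. Y (Suc q) i w) ` {1..Suc q} = {n. \<exists>i\<in>{1..Suc q}. Y (Suc q) i w = n}" by blast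
      thus "N (Suc q) w = Max {n. \<exists>i\<in>{1..Suc q}. Y (Suc q) i w = n}"
        using assms(6)[of "Suc q" w] by simp
    qed
    thus ?thesis using measurable_Max_nat[OF pred] by simp
  qed
  have meas_K: "K q \<in> M (Suc q) \<rightarrow>\<^sub>M count_space UNIV" for q
    unfolding K_def using meas_N[of q] by measurable
  have meas_L: "L q \<in> P \<rightarrow>\<^sub>M count_space UNIV" for q
    unfolding L_def by measurable
  \<comment> \<open>For m + k < 0 the event is empty, since the maximum is a natural number.\<close>
  have FK: "FK q k = (if 0 \<le> m q + k then F q (nat (m q + k)) else 0)" for q k
  proof -
    have "{w \<in> space (M (Suc q)). K q w \<le> k} =
      (if 0 \<le> m q + k then {w \<in> space (M (Suc q)). N (Suc q) w \<le> nat (m q + k)} else {})"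
      by (auto simp: K_def)
    also have "N (Suc q) = (\<lambda>w. MAX i\<in>{1..Suc q}. Y (Suc q) i w)"
      using assms(6)[of "Suc q"] by (simp add: fun_eq_iff)
    finally have "{w \<in> space (M (Suc q)). K q w \<le> k} = (if 0 \<le> m q + k
      then {w \<in> space (M (Suc q)). (MAX i\<in>{1..Suc q}. Y (Suc q) i w) \<le> nat (m q + k)} else {})" .
    thus ?thesis
      using prob_Max_le_iid[OF assms(3) _ assms(4) assms(5), of "Suc q" "nat (m q + k)"]
      by (simp add: FK_def F_def)
  qed
  have FL: "FL q k = exp (- exp (- x q k))" for q k
  proof -
    have "L q w \<le> k \<longleftrightarrow> Z w \<le> x q k" for w
    proof -
      have "L q w \<le> k \<longleftrightarrow> b q + Z w / \<alpha> \<le> real_of_int (m q + k)"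
        by (simp add: L_def ceiling_le_iff algebra_simps)
      also have "\<dots> \<longleftrightarrow> Z w \<le> x q k"
        using \<alpha> by (simp add: x_def field_simps)
      finally show ?thesis .
    qed
    thus ?thesis using gumbel_cdf[OF Z] by (simp add: FL_def)
  qed

  \<comment> \<open>The factor exp \<alpha> pays for the unit of rounding in
    \<open>x_bounds\<close>, the factor a for the bound a/u on the left tail.\<close>
  define C where "C = real a * exp \<alpha>"
  have C: "exp \<alpha> \<le> C" using a by (simp add: C_def)
  have up: "exp (- x q (k - 1)) \<le> C * exp (- \<alpha> * k)" for q and k :: int
  proof -
    have "exp (- x q (k - 1)) \<le> exp (\<alpha> - \<alpha> * k)"
      using x_bounds(1)[of "k - 1" q] by (simp add: algebra_simps)
    also have "\<dots> = exp \<alpha> * exp (- \<alpha> * k)" by (simp add: mult_exp_exp)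
    also have "\<dots> \<le> C * exp (- \<alpha> * k)" using C by (intro mult_right_mono) auto
    finally show ?thesis .
  qed
  have lo: "real a * exp (x q k) \<le> C * exp (\<alpha> * k)" for q and k :: int
  proof -
    have "exp (x q k) \<le> exp (\<alpha> + \<alpha> * k)"
      using x_bounds(2)[of q k] by (simp add: algebra_simps)
    thus ?thesis
      using mult_left_mono[of "exp (x q k)" _ "real a"] by (simp add: C_def exp_add mult.assoc)
  qed
  have tails:
    "k \<ge> 1 \<Longrightarrow> 1 - FK q (k - 1) \<le> C * exp (- \<alpha> * k)" "k \<le> 0 \<Longrightarrow> FK q k \<le> C * exp (\<alpha> * k)"
    "1 - FL q (k - 1) \<le> C * exp (- \<alpha> * k)" "FL q k \<le> C * exp (\<alpha> * k)" for q and k :: int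
  proof -
    note t = coupon_maximum_cdf_tails[OF a, of "Suc q", folded \<rho>_def]
    show "1 - FK q (k - 1) \<le> C * exp (- \<alpha> * k)" if "k \<ge> 1"
    proof -
      have nn: "0 \<le> m q + (k - 1)" using m0[of q] that by simp
      have "1 - FK q (k - 1) \<le> exp (- x q (k - 1))"
        using t(1)[of "nat (m q + (k - 1))"] unfolding u_eq[OF nn] FK F_def using nn by simp
      thus ?thesis using up[of q k] by simp
    qed
    show "FK q k \<le> C * exp (\<alpha> * k)"
    proof (cases "0 \<le> m q + k")
      case True
      have "FK q k \<le> real a / exp (- x q k)"
        using t(2)[of "nat (m q + k)"] unfolding u_eq[OF True] FK F_def using True by simp
      thus ?thesis using lo[of q k] by (simp add: exp_minus field_simps)
    next
      case False
      thus ?thesis using a by (simp add: FK C_def)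
    qed
    show "1 - FL q (k - 1) \<le> C * exp (- \<alpha> * k)"
      using exp_ge_add_one_self[of "- exp (- x q (k - 1))"] up[of q k] unfolding FL by simp
    \<comment> \<open>From exp (-x) >= 1 - x it follows that -exp (-x) <= x.\<close>
    have "FL q k \<le> exp (x q k)"
      using exp_ge_add_one_self[of "- x q k"] unfolding FL by simp
    also have "\<dots> \<le> real a * exp (x q k)" using a by simp
    also note lo
    finally show "FL q k \<le> C * exp (\<alpha> * k)" .
  qed

  \<comment> \<open>For fixed k the index m + k tends to infinity while u = exp (-x) stays below exp
    (-\<alpha> k), so the approximation error, u times geometric terms, vanishes.\<close>
  have lim: "(\<lambda>q. FK q k - FL q k) \<longlonglongrightarrow> 0" for k
  proof -
    define \<sigma> where "\<sigma> = (real a - 2) / (real a - 1)"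
    have \<sigma>: "0 \<le> \<sigma>" "\<sigma> < 1" using a by (auto simp: \<sigma>_def field_simps)
    define s where "s = (\<lambda>n. exp (- \<alpha> * k) * ((real a - 1) * \<sigma> ^ n + real a * \<rho> ^ n))"
    have s: "s \<longlonglongrightarrow> 0"
      unfolding s_def using \<sigma> \<rho>
      by (auto intro!: tendsto_eq_intros LIMSEQ_power_zero)
    have b: "filterlim b at_top sequentially"
      unfolding b_def using a \<alpha> by real_asymp
    have mk: "filterlim (\<lambda>q. m q + k) at_top sequentially"
      unfolding filterlim_at_top
    proof
      fix z :: int
      have "eventually (\<lambda>q. real_of_int (z - k) \<le> b q) sequentially"
        using b by (simp add: filterlim_at_top)
      thus "eventually (\<lambda>q. z \<le> m q + k) sequentially"
      proof eventually_elim
        case (elim q)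
        thus ?case using mb(1)[of q] by linarith
      qed
    qed
    have ev: "eventually (\<lambda>q. 0 \<le> m q + k) sequentially"
      using mk by (simp add: filterlim_at_top)
    have "filterlim (\<lambda>q. nat (m q + k)) sequentially sequentially"
      using mk by (rule filterlim_compose[OF filterlim_nat_sequentially])
    from filterlim_compose[OF s this] have "(\<lambda>q. s (nat (m q + k))) \<longlonglongrightarrow> 0" .
    moreover have "eventually (\<lambda>q. norm (FK q k - FL q k) \<le> s (nat (m q + k))) sequentially"
      using ev
    proof eventually_elim
      case (elim q)
      have "norm (FK q k - FL q k) \<le>
         exp (- x q k) * ((real a - 1) * \<sigma> ^ nat (m q + k) + real a * \<rho> ^ nat (m q + k))"
        using coupon_maximum_cdf_approx[OF a, of "nat (m q + k)" "Suc q", folded \<rho>_def \<sigma>_def]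
        unfolding u_eq[OF elim] FK FL F_def using elim by simp
      also have "\<dots> \<le> s (nat (m q + k))"
        unfolding s_def using x_bounds(1)[of k q] a \<sigma> \<rho> by (intro mult_right_mono) auto
      finally show ?case .
    qed
    ultimately show ?thesis by (rule Lim_null_comparison[rotated])
  qed

  \<comment> \<open>Comparison of the variances\<close>
  have M: "prob_space (M (Suc q))" for q by (rule assms(3)) simp
  have integrable_K: "integrable (M (Suc q)) (\<lambda>w. real_of_int (K q w))"
    and var_lim: "(\<lambda>q. prob_space.variance (M (Suc q)) (\<lambda>w. real_of_int (K q w)) -
         P.variance (\<lambda>w. real_of_int (L q w))) \<longlonglongrightarrow> 0" for q
  proof -
    have bK: "measure (M (Suc q)) {w \<in> space (M (Suc q)). K q w = k} \<le> C * exp (- \<alpha> * \<bar>k\<bar>)" for q k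
      by (rule int_rv_point_prob_le_geometric[OF M meas_K])
         (use tails(1,2)[of _ q] in \<open>simp_all add: FK_def\<close>)
    have bL: "P.prob {w \<in> space P. L q w = k} \<le> C * exp (- \<alpha> * \<bar>k\<bar>)" for q k
      by (rule int_rv_point_prob_le_geometric[OF P meas_L])
         (use tails(3,4)[of q] in \<open>simp_all add: FL_def\<close>)
    have "(\<lambda>q. (FK q k - FL q k) - (FK q (k - 1) - FL q (k - 1))) \<longlonglongrightarrow> 0 - 0" for k
      by (intro tendsto_diff lim)
    hence pl: "(\<lambda>q. measure (M (Suc q)) {w \<in> space (M (Suc q)). K q w = k} -
               P.prob {w \<in> space P. L q w = k}) \<longlonglongrightarrow> 0" for k
      unfolding int_rv_point_prob[OF M meas_K] int_rv_point_prob[OF P meas_L] FK_def FL_def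
      by (simp add: algebra_simps)
    show "integrable (M (Suc q)) (\<lambda>w. real_of_int (K q w))"
      "(\<lambda>q. prob_space.variance (M (Suc q)) (\<lambda>w. real_of_int (K q w)) -
         P.variance (\<lambda>w. real_of_int (L q w))) \<longlonglongrightarrow> 0"
      using variance_difference_tendsto_0[where M = "\<lambda>q. M (Suc q)" and N = "\<lambda>_. P" and X = K and Y = L,
          OF M P meas_K meas_L \<alpha> bK bL pl] by auto
  qed
  have var_N: "prob_space.variance (M (Suc q)) (\<lambda>w. real (N (Suc q) w)) =
               prob_space.variance (M (Suc q)) (\<lambda>w. real_of_int (K q w))" for q
  proof -
    interpret prob_space "M (Suc q)" by (rule M)
    have N: "real (N (Suc q) w) = real_of_int (K q w) + real_of_int (m q)" for w
      by (simp add: K_def)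
    show ?thesis unfolding N using integrable_K[of q] by (simp add: prob_space)
  qed

  \<comment> \<open>Passage to the upper limit\<close>
  define \<Theta> where "\<Theta> = theta P Z \<alpha>"
  define E where "E = 2 * (euler_mascheroni + exp_integral_E1 1) / \<alpha>"
  have \<theta>: "0 < \<Theta>" "\<Theta> < 1" unfolding \<Theta>_def by (rule theta_bounds[OF P Z \<alpha>])+
  have "exp (- 1 :: real) \<le> 1 / 2"
    using exp_ge_add_one_self[of "1::real"] by (simp add: exp_minus field_simps)
  \<comment> \<open>The rounding variance takes up only 1/4 < 1 - exp (-1). The strict surplus
    absorbs the vanishing difference of variances, so the bound holds for all large q.\<close>
  hence slack: "0 < \<Theta> + 1 - exp (- 1) - 1 / 4" using \<theta> by linarith
  have L_bound: "\<bar>P.variance (\<lambda>w. real_of_int (L q w)) - pi\<^sup>2 / (6 * \<alpha>\<^sup>2)\<bar> \<le> 1 / 4 + E" for q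
    unfolding L_def E_def by (rule gumbel_ceiling_variance[OF P Z \<alpha>])
  have "eventually (\<lambda>q. \<bar>prob_space.variance (M (Suc q)) (\<lambda>w. real_of_int (K q w)) -
         P.variance (\<lambda>w. real_of_int (L q w))\<bar> < \<Theta> + 1 - exp (- 1) - 1 / 4) sequentially"
    using tendstoD[OF var_lim slack] by (simp add: dist_real_def)
  hence "eventually (\<lambda>q. \<bar>prob_space.variance (M (Suc q)) (\<lambda>w. real (N (Suc q) w)) - pi\<^sup>2 / (6 * \<alpha>\<^sup>2)\<bar>
             \<le> \<Theta> + 1 - exp (- 1) + E) sequentially"
    unfolding var_N
  proof eventually_elim
    case (elim q)
    thus ?case using L_bound[of q] by linarith
  qed
  \<comment> \<open>The index shift by one is undone here.\<close>
  hence "eventually (\<lambda>q. \<bar>prob_space.variance (M q) (\<lambda>w. real (N q w)) - pi\<^sup>2 / (6 * \<alpha>\<^sup>2)\<bar>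
             \<le> \<Theta> + 1 - exp (- 1) + E) sequentially"
    by (subst (asm) eventually_sequentially_Suc)
  hence "limsup (\<lambda>q. ereal \<bar>prob_space.variance (M q) (\<lambda>w. real (N q w)) - pi\<^sup>2 / (6 * \<alpha>\<^sup>2)\<bar>)
           \<le> ereal (\<Theta> + 1 - exp (- 1) + E)"
    by (intro Limsup_bounded) simp
  thus ?thesis using \<theta> unfolding \<Theta>_def E_def by blast
qed

end
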